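(* Let $\gamma>0$ and let $\phi:\mathbb{H}_\gamma\to\mathbb{R}$ be a positive bounded (measurable) radial function. (a) If $\gamma=\frac mn$ is rational, with $m,n$ positive integers and $\gcd(m,n)=1$, then $T_\phi$ does not map $L^p(\mathbb{H}_\gamma)$ to $A^p(\mathbb{H}_\gamma)$ for any $p\ge\frac{2m+2n}{m+n-1}$. (b) If $\gamma$ is irrational, then $T_\phi$ does not map $L^p(\mathbb{H}_\gamma)$ to $A^p(\mathbb{H}_\gamma)$ for any $p>2$.
   Context: For $\gamma>0$ the generalized Hartogs triangle is $\mathbb{H}_\gamma=\{(z_1,z_2)\in\mathbb{C}^2: |z_1|^\gamma<|z_2|<1\}$. $dV$ is Lebesgue measure, $L^p(\mathbb{H}_\gamma)$ is taken with respect to $dV$, and $A^p(\mathbb{H}_\gamma)$ is the space of holomorphic functions in $L^p(\mathbb{H}_\gamma)$. A function $\phi$ on $\mathbb{H}_\gamma$ is radial if $\phi(z_1,z_2)=\phi(|z_1|,|z_2|)$. The Bergman projection $\mathbf{B}_\gamma$ is the orthogonal projection of $L^2(\mathbb{H}_\gamma)$ onto its closed subspace $A^2(\mathbb{H}_\gamma)$; it is the integral operator $\mathbf{B}_\gamma f(z)=\int_{\mathbb{H}_\gamma}B_\gamma(z,w)f(w)\,dV(w)$, where $B_\gamma(z,w)$ is the Bergman kernel. For a bounded symbol $\phi$, the Toeplitz operator is $T_\phi f(z)=\mathbf{B}_\gamma(\phi f)(z)=\int_{\mathbb{H}_\gamma}B_\gamma(z,w)f(w)\phi(w)\,dV(w)$.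 All exponents $p$ in the statement exceed $2$, so $L^p(\mathbb{H}_\gamma)\subset L^2(\mathbb{H}_\gamma)$ and $T_\phi$ is defined on $L^p(\mathbb{H}_\gamma)$; "$T_\phi$ does not map $L^p$ to $A^p$" means that there is $f\in L^p$ with $T_\phi f\notin A^p$. *)

theory Defs
  imports "HOL-Analysis.Analysis"
begin

definition hartogs :: "real \<Rightarrow> (complex \<times> complex) set" where
  "hartogs \<gamma> = {(z\<^sub>1, z\<^sub>2). cmod z\<^sub>1 powr \<gamma> < cmod z\<^sub>2 \<and> cmod z\<^sub>2 < 1}"

text \<open>
  Holomorphy in two variables is complex differentiability: at each point there is a
  (Frechet) derivative which is linear over the complex numbers. It is only used for open sets.
\<close>

definition holomorphic2_on :: "(complex \<times> complex \<Rightarrow> complex) \<Rightarrow> (complex \<times> complex) set \<Rightarrow> bool" where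
  "holomorphic2_on f \<Omega> \<longleftrightarrow>
     (\<forall>z\<in>\<Omega>. \<exists>a b. (f has_derivative (\<lambda>(h\<^sub>1, h\<^sub>2). a * h\<^sub>1 + b * h\<^sub>2)) (at z within \<Omega>))"

text \<open>
  Elements of the spaces below are functions on all of \<open>\<complex>\<^sup>2\<close> of which only the restriction to
  \<open>\<Omega>\<close> matters; they are not identified when they agree almost everywhere.
\<close>

definition Lp_on :: "(complex \<times> complex) set \<Rightarrow> real \<Rightarrow> (complex \<times> complex \<Rightarrow> complex) set" where
  "Lp_on \<Omega> p = {f \<in> borel_measurable (lebesgue_on \<Omega>).
                  integrable (lebesgue_on \<Omega>) (\<lambda>z. cmod (f z) powr p)}"

definition Ap_on :: "(complex \<times> complex) set \<Rightarrow> real \<Rightarrow> (complex \<times> complex \<Rightarrow> complex) set" where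
  "Ap_on \<Omega> p = {f \<in> Lp_on \<Omega> p. holomorphic2_on f \<Omega>}"

definition L2_inner ::
  "(complex \<times> complex) set \<Rightarrow> (complex \<times> complex \<Rightarrow> complex) \<Rightarrow> (complex \<times> complex \<Rightarrow> complex) \<Rightarrow> complex"
where
  "L2_inner \<Omega> f g = (LINT z|lebesgue_on \<Omega>. f z * cnj (g z))"

text \<open>
  For \<open>f\<close> in \<open>L\<^sup>2(\<Omega>)\<close> with \<open>\<Omega>\<close> open, the orthogonal projection of \<open>f\<close> onto \<open>A\<^sup>2(\<Omega>)\<close>: the element
  \<open>g\<close> of \<open>A\<^sup>2(\<Omega>)\<close> with \<open>f - g\<close> orthogonal to \<open>A\<^sup>2(\<Omega>)\<close>. As a holomorphic function it is determined
  everywhere on \<open>\<Omega>\<close>; fixing the value 0 outside \<open>\<Omega>\<close> makes the description definite.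
\<close>

definition bergman_projection ::
  "(complex \<times> complex) set \<Rightarrow> (complex \<times> complex \<Rightarrow> complex) \<Rightarrow> complex \<times> complex \<Rightarrow> complex"
where
  "bergman_projection \<Omega> f =
     (THE g. g \<in> Ap_on \<Omega> 2 \<and> (\<forall>z. z \<notin> \<Omega> \<longrightarrow> g z = 0) \<and>
             (\<forall>h \<in> Ap_on \<Omega> 2. L2_inner \<Omega> (\<lambda>z. f z - g z) h = 0))"

definition toeplitz ::
  "(complex \<times> complex) set \<Rightarrow> (complex \<times> complex \<Rightarrow> real) \<Rightarrow>
     (complex \<times> complex \<Rightarrow> complex) \<Rightarrow> complex \<times> complex \<Rightarrow> complex"
where
  "toeplitz \<Omega> \<phi> f = bergman_projection \<Omega> (\<lambda>z. complex_of_real (\<phi> z) * f z)"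

text \<open>The point \<open>(\<bar>z\<^sub>1\<bar>, \<bar>z\<^sub>2\<bar>)\<close> again lies in \<open>hartogs \<gamma>\<close>.\<close>

definition radial_on :: "(complex \<times> complex) set \<Rightarrow> (complex \<times> complex \<Rightarrow> real) \<Rightarrow> bool" where
  "radial_on \<Omega> \<phi> \<longleftrightarrow>
     (\<forall>(z\<^sub>1, z\<^sub>2) \<in> \<Omega>. \<phi> (z\<^sub>1, z\<^sub>2) = \<phi> (complex_of_real (cmod z\<^sub>1), complex_of_real (cmod z\<^sub>2)))"

end

theory Submission
  imports Defs "HOL-Complex_Analysis.Complex_Analysis"
begin

text \<open>
  The torus acts on the Hartogs triangle by rotations, and the torus average of a holomorphic
  function against a character is a multiple of the corresponding Laurent monomial. Hence, for a
  radial symbol \<open>\<phi>\<close>, the projection of \<open>\<phi> z\<^sub>1\<^sup>a cnj(z\<^sub>2)\<^sup>k\<close> is \<open>c z\<^sub>1\<^sup>a z\<^sub>2\<^sup>-\<^sup>k\<close> whenever this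
  monomial is square integrable, and \<open>c > 0\<close> because \<open>\<phi>\<close> is positive. The monomial is in \<open>L\<^sup>p\<close> iff
  \<open>p (\<gamma> k - a) < 2 + 2 \<gamma>\<close>, so it remains to choose \<open>a\<close> and \<open>k\<close> such that \<open>\<gamma> k - a\<close> is below
  \<open>1 + \<gamma>\<close>, but as close to it as \<open>p\<close> requires: for \<open>\<gamma> = m / n\<close> the largest possible value is
  \<open>(m + n - 1) / n\<close>, and for irrational \<open>\<gamma>\<close> the values are dense.
\<close>

subsection \<open>Rotation invariance of Lebesgue measure\<close>

text \<open>The conjugate in \<open>cnj(z\<^sub>2)\<^sup>k\<close> is what makes the test function
  work: under rotations it turns exactly like \<open>z\<^sub>2\<^sup>-\<^sup>k\<close>, yet on the
  triangle it is bounded by 1, so the test function lies in every L^p and the singularity arises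
  only through the projection. Neither the Bergman kernel nor an orthonormal basis is computed. The
  projection is guessed as a multiple of one monomial, with the constant dictated by orthogonality
  to that monomial; averaging over the torus reduces orthogonality to an arbitrary element of A^2 to
  this single case. The line \<open>z\<^sub>1 = 0\<close>, where logarithms break down, is a null
  set and is discarded. The critical exponent for \<open>\<gamma> = m / n\<close> is
  \<open>2 + 2 \<gamma>\<close> divided by \<open>(m + n - 1) / n\<close>. The integrability
  criterion is a strict inequality, so the monomial already fails to be in L^p at equality; this is
  why the endpoint belongs to the excluded range of \<open>p\<close>.\<close>

definition rot :: "real \<times> real \<Rightarrow> complex \<times> complex \<Rightarrow> complex \<times> complex" where
  "rot \<theta> z = (cis (fst \<theta>) * fst z, cis (snd \<theta>) * snd z)"

text \<open>
  The library has the invariance of Lebesgue measure under orthogonal maps only for \<open>real ^ 'n\<close>; it is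
  transported to \<open>\<complex>\<^sup>2\<close> along this isometry.
\<close>

definition c2_of_vec :: "real ^ 4 \<Rightarrow> complex \<times> complex" where
  "c2_of_vec v = (Complex (v $ 1) (v $ 2), Complex (v $ 3) (v $ 4))"

definition vec_of_c2 :: "complex \<times> complex \<Rightarrow> real ^ 4" where
  "vec_of_c2 z = vector [Re (fst z), Im (fst z), Re (snd z), Im (snd z)]"

lemma vec_of_c2_nth:
  "vec_of_c2 z $ 1 = Re (fst z)" "vec_of_c2 z $ 2 = Im (fst z)"
  "vec_of_c2 z $ 3 = Re (snd z)" "vec_of_c2 z $ 4 = Im (snd z)"
  by (simp_all add: vec_of_c2_def vector_def)

lemma c2_of_vec_of_c2 [simp]: "c2_of_vec (vec_of_c2 z) = z"
  by (simp add: c2_of_vec_def vec_of_c2_nth complex_eq_iff prod_eq_iff)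

lemma vec_of_c2_of_vec [simp]: "vec_of_c2 (c2_of_vec v) = v"
  by (simp add: c2_of_vec_def vec_eq_iff forall_4 vec_of_c2_nth)

lemma linear_vec_of_c2: "linear vec_of_c2"
  by (intro linearI) (simp_all add: vec_eq_iff forall_4 vec_of_c2_nth)

lemma linear_c2_of_vec: "linear c2_of_vec"
  by (intro linearI) (simp_all add: c2_of_vec_def complex_eq_iff)

lemma norm_c2_of_vec: "norm (c2_of_vec v) = norm v"
  by (simp add: c2_of_vec_def norm_Pair norm_vec_def L2_set_def sum_4 cmod_def add.assoc)

lemma norm_vec_of_c2: "norm (vec_of_c2 z) = norm z"
  using norm_c2_of_vec[of "vec_of_c2 z"] by simp

lemma c2_of_vec_borel [measurable]: "c2_of_vec \<in> borel_measurable borel"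
  by (intro borel_measurable_continuous_onI linear_continuous_on linear_c2_of_vec linear_linear[THEN iffD2])

lemma Basis_c2: "(Basis :: (complex \<times> complex) set) = {(1,0), (\<i>,0), (0,1), (0,\<i>)}"
  by (auto simp: Basis_prod_def Basis_complex_def)

text \<open>Boxes pull back to boxes with the same side lengths, and a measure that gives every box
  its volume is Lebesgue measure.\<close>

lemma lborel_c2: "lborel = distr lborel borel c2_of_vec"
proof (rule lborel_eqI)
  fix l u :: "complex \<times> complex"
  assume le: "\<And>b. b \<in> Basis \<Longrightarrow> l \<bullet> b \<le> u \<bullet> b"
  have eq: "c2_of_vec -` box l u = box (vec_of_c2 l) (vec_of_c2 u)"
    by (intro set_eqI, simp only: vimage_eq mem_box_cart forall_4 vec_of_c2_nth)
       (auto simp: mem_box Basis_c2 inner_prod_def c2_of_vec_def)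
  have inj: "inj (\<lambda>i::4. axis i (1::real))"
    by (auto simp: inj_def axis_eq_axis)
  have B: "(Basis :: (real^4) set) = (\<lambda>i. axis i 1) ` UNIV"
    by (auto simp: Basis_vec_def)
  have le': "vec_of_c2 l $ i \<le> vec_of_c2 u $ i" for i
  proof -
    have "Re (fst l) \<le> Re (fst u)" "Im (fst l) \<le> Im (fst u)" "Re (snd l) \<le> Re (snd u)" "Im (snd l) \<le> Im (snd u)"
      using le[of "(1,0)"] le[of "(\<i>,0)"] le[of "(0,1)"] le[of "(0,\<i>)"]
      by (simp_all add: Basis_c2 inner_prod_def)
    then show ?thesis
      using exhaust_4[of i] by (elim disjE) (simp_all add: vec_of_c2_nth)
  qed
  have "emeasure lborel (box (vec_of_c2 l) (vec_of_c2 u)) = (\<Prod>b\<in>Basis. (vec_of_c2 u - vec_of_c2 l) \<bullet> b)"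
    using le' by (intro emeasure_lborel_box) (auto simp: B inner_axis)
  also have "(\<Prod>b\<in>Basis. (vec_of_c2 u - vec_of_c2 l) \<bullet> b) = (\<Prod>i\<in>UNIV. (vec_of_c2 u - vec_of_c2 l) $ i)"
    unfolding B by (subst prod.reindex[OF inj]) (simp add: inner_axis)
  also have "\<dots> = (Re (fst u) - Re (fst l)) * (Im (fst u) - Im (fst l)) * (Re (snd u) - Re (snd l)) * (Im (snd u) - Im (snd l))"
    unfolding UNIV_4 by (simp add: vec_of_c2_nth mult_ac)
  also have "\<dots> = (\<Prod>b\<in>Basis. (u - l) \<bullet> b)"
    unfolding Basis_c2 by (simp add: inner_prod_def mult_ac)
  finally show "emeasure (distr lborel borel c2_of_vec) (box l u) = (\<Prod>b\<in>Basis. (u - l) \<bullet> b)"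
    by (simp add: emeasure_distr eq)
qed simp

lemma rot_borel [measurable]: "rot \<theta> \<in> borel_measurable borel"
  unfolding rot_def by (intro borel_measurable_continuous_onI continuous_intros)

lemma rot_rot_uminus [simp]: "rot (-\<theta>) (rot \<theta> z) = z" "rot \<theta> (rot (-\<theta>) z) = z"
  by (simp_all add: rot_def cis_mult flip: mult.assoc)

lemma norm_rot: "norm (rot \<theta> z) = norm z"
  by (simp add: rot_def norm_Pair norm_mult norm_prod_def)

lemma linear_rot: "linear (rot \<theta>)"
  by (intro linearI) (simp_all add: rot_def algebra_simps)

lemma distr_lborel_rot: "distr lborel lborel (rot \<theta>) = lborel"
proof (rule lborel_eqI[symmetric])
  fix l u :: "complex \<times> complex"
  assume le: "\<And>b. b \<in> Basis \<Longrightarrow> l \<bullet> b \<le> u \<bullet> b"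
  let ?A = "c2_of_vec -` box l u"
  \<comment> \<open>The angle is \<open>-\<theta>\<close> because a preimage under
    \<open>rot \<theta>\<close> is to become an image under \<open>g\<close>; preservation of
    measure by orthogonal maps is available for images.\<close>
  define g where "g = vec_of_c2 \<circ> rot (-\<theta>) \<circ> c2_of_vec"
  have "linear g"
    unfolding g_def by (intro linear_compose linear_vec_of_c2 linear_rot linear_c2_of_vec)
  moreover have "norm (g v) = norm v" for v
    by (simp add: g_def norm_vec_of_c2 norm_rot norm_c2_of_vec)
  ultimately have g: "orthogonal_transformation g"
    by (simp add: orthogonal_transformation)
  have A: "?A \<in> sets borel"
    by (metis c2_of_vec_borel borel_open measurable_sets_borel open_box)
  have emA: "emeasure lborel ?A = emeasure lborel (box l u)"
    by (subst lborel_c2) (simp add: emeasure_distr)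
  have Am: "?A \<in> lmeasurable"
    using A emA emeasure_lborel_box_finite[of l u] by (intro fmeasurableI) auto
  have im: "g ` ?A = (rot \<theta> \<circ> c2_of_vec) -` box l u"
  proof (intro equalityI subsetI)
    fix v assume "v \<in> (rot \<theta> \<circ> c2_of_vec) -` box l u"
    moreover have "v = g (vec_of_c2 (rot \<theta> (c2_of_vec v)))"
      by (simp add: g_def)
    ultimately show "v \<in> g ` ?A"
      by (metis c2_of_vec_of_c2 image_eqI vimage_eq comp_apply)
  qed (auto simp: g_def)
  have R: "rot \<theta> -` box l u \<in> sets borel"
    by (rule measurable_sets_borel[OF rot_borel borel_open[OF open_box]])
  have "emeasure lborel (rot \<theta> -` box l u) = emeasure (distr lborel borel c2_of_vec) (rot \<theta> -` box l u)"
    by (rule arg_cong[where f = "\<lambda>M. emeasure M _", OF lborel_c2])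
  also have "\<dots> = emeasure lborel (c2_of_vec -` (rot \<theta> -` box l u))"
    using emeasure_distr[OF _ R, of c2_of_vec lborel] by simp
  also have "\<dots> = emeasure lborel ((rot \<theta> \<circ> c2_of_vec) -` box l u)"
    by (simp only: vimage_comp)
  also have "\<dots> = emeasure lebesgue (g ` ?A)"
    unfolding im using measurable_sets_borel[OF measurable_comp[OF c2_of_vec_borel rot_borel] borel_open[OF open_box], of \<theta> l u]
    by simp
  also have "\<dots> = emeasure lebesgue ?A"
    using measurable_orthogonal_image[OF g Am] measure_orthogonal_image[OF g Am] Am
    by (simp add: emeasure_eq_measure2)
  also have "\<dots> = emeasure lborel (box l u)"
    using A emA by simp
  finally show "emeasure (distr lborel lborel (rot \<theta>)) (box l u) = (\<Prod>b\<in>Basis. (u - l) \<bullet> b)"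
    using le by (simp add: emeasure_distr emeasure_lborel_box)
qed simp

text \<open>Since rotations preserve the Borel measure, they pull null sets back to null sets, so
  measurability and invariance both survive completion.\<close>

lemma
  shows rot_measurable_lebesgue: "rot \<theta> \<in> lebesgue \<rightarrow>\<^sub>M lebesgue"
    and distr_lebesgue_rot: "distr lebesgue lebesgue (rot \<theta>) = lebesgue"
proof -
  have eq: "distr lebesgue lborel (rot \<theta>) = lborel"
    by (simp add: distr_completion distr_lborel_rot)
  show "rot \<theta> \<in> lebesgue \<rightarrow>\<^sub>M lebesgue"
    by (rule completion.measurable_completion2) (simp_all add: eq measurable_completion)
  have "distr lebesgue lebesgue (rot \<theta>) = completion (distr lebesgue lborel (rot \<theta>))"
    by (rule completion.completion_distr_eq[symmetric]) (simp_all add: eq measurable_completion)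
  then show "distr lebesgue lebesgue (rot \<theta>) = lebesgue"
    by (simp add: eq)
qed

lemma
  assumes S: "S \<in> sets lebesgue" and inv: "\<And>z. rot \<theta> z \<in> S \<longleftrightarrow> z \<in> S"
  shows rot_measurable_lebesgue_on: "rot \<theta> \<in> lebesgue_on S \<rightarrow>\<^sub>M lebesgue_on S"
    and distr_lebesgue_on_rot: "distr (lebesgue_on S) (lebesgue_on S) (rot \<theta>) = lebesgue_on S"
proof -
  show m: "rot \<theta> \<in> lebesgue_on S \<rightarrow>\<^sub>M lebesgue_on S"
    by (intro measurable_restrict_space3 rot_measurable_lebesgue) (simp add: inv)
  show "distr (lebesgue_on S) (lebesgue_on S) (rot \<theta>) = lebesgue_on S"
  proof (rule measure_eqI)
    fix A assume "A \<in> sets (distr (lebesgue_on S) (lebesgue_on S) (rot \<theta>))"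
    then have A: "A \<in> sets lebesgue" "A \<subseteq> S" "A \<in> sets (lebesgue_on S)"
      using S by (auto simp: sets_restrict_space_iff)
    have eq: "rot \<theta> -` A \<inter> space (lebesgue_on S) = rot \<theta> -` A"
      using A inv[symmetric] by fastforce
    have sub: "rot \<theta> -` A \<subseteq> S"
      using A inv by blast
    have "emeasure (distr (lebesgue_on S) (lebesgue_on S) (rot \<theta>)) A = emeasure lebesgue (rot \<theta> -` A)"
      using A S sub by (simp add: emeasure_distr[OF m] emeasure_restrict_space Int_absorb2)
    also have "\<dots> = emeasure (distr lebesgue lebesgue (rot \<theta>)) A"
      using A by (simp add: emeasure_distr rot_measurable_lebesgue)
    finally show "emeasure (distr (lebesgue_on S) (lebesgue_on S) (rot \<theta>)) A = emeasure (lebesgue_on S) A"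
      using A S by (simp add: distr_lebesgue_rot emeasure_restrict_space)
  qed simp
qed

subsection \<open>Torus means of holomorphic functions\<close>

lemma open_hartogs:
  assumes "\<gamma> > 0"
  shows "open (hartogs \<gamma>)"
proof -
  have eq: "hartogs \<gamma> = {z. cmod (fst z) powr \<gamma> < cmod (snd z)} \<inter> {z. cmod (snd z) < 1}"
    by (auto simp: hartogs_def)
  have c: "continuous_on UNIV (\<lambda>z::complex \<times> complex. cmod (fst z) powr \<gamma>)"
    using assms by (intro continuous_on_powr' continuous_intros) auto
  show ?thesis
    unfolding eq by (intro open_Int open_Collect_less c continuous_intros)
qed

lemma rot_in_hartogs_iff: "rot \<theta> z \<in> hartogs \<gamma> \<longleftrightarrow> z \<in> hartogs \<gamma>"
  by (cases z) (simp add: rot_def hartogs_def norm_mult)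

lemma holomorphic2_on_imp_continuous_on:
  "holomorphic2_on f \<Omega> \<Longrightarrow> continuous_on \<Omega> f"
  unfolding holomorphic2_on_def by (meson continuous_on_eq_continuous_within has_derivative_continuous)

text \<open>Composing the derivative with \<open>h \<mapsto> (h, 0)\<close> or
  \<open>h \<mapsto> (0, h)\<close> leaves a single complex multiple of \<open>h\<close>. The torus
  means need only continuity and one-variable function theory in each slice.\<close>

lemma holomorphic2_on_partial:
  assumes f: "holomorphic2_on f \<Omega>" and "open \<Omega>" and z: "(z\<^sub>1, z\<^sub>2) \<in> \<Omega>"
  shows "(\<lambda>w. f (w, z\<^sub>2)) field_differentiable at z\<^sub>1" "(\<lambda>w. f (z\<^sub>1, w)) field_differentiable at z\<^sub>2"
proof -
  obtain a b where D: "(f has_derivative (\<lambda>(h\<^sub>1, h\<^sub>2). a * h\<^sub>1 + b * h\<^sub>2)) (at (z\<^sub>1, z\<^sub>2))"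
    using f z \<open>open \<Omega>\<close> unfolding holomorphic2_on_def by (metis at_within_open)
  have "((\<lambda>w. f (w, z\<^sub>2)) has_derivative (\<lambda>h. (\<lambda>(h\<^sub>1, h\<^sub>2). a * h\<^sub>1 + b * h\<^sub>2) (h, 0))) (at z\<^sub>1)"
    using has_derivative_compose[OF has_derivative_Pair[OF has_derivative_ident has_derivative_const] D] .
  then have "((\<lambda>w. f (w, z\<^sub>2)) has_field_derivative a) (at z\<^sub>1)"
    by (simp add: has_field_derivative_def)
  then show "(\<lambda>w. f (w, z\<^sub>2)) field_differentiable at z\<^sub>1"
    by (auto simp: field_differentiable_def)
  have "((\<lambda>w. f (z\<^sub>1, w)) has_derivative (\<lambda>h. (\<lambda>(h\<^sub>1, h\<^sub>2). a * h\<^sub>1 + b * h\<^sub>2) (0, h))) (at z\<^sub>2)"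
    using has_derivative_compose[OF has_derivative_Pair[OF has_derivative_const has_derivative_ident] D] .
  then have "((\<lambda>w. f (z\<^sub>1, w)) has_field_derivative b) (at z\<^sub>2)"
    by (simp add: has_field_derivative_def)
  then show "(\<lambda>w. f (z\<^sub>1, w)) field_differentiable at z\<^sub>2"
    by (auto simp: field_differentiable_def)
qed

section \<open>Averages over the circle and the torus\<close>

definition circle_measure :: "real measure" where
  "circle_measure = restrict_space lborel {0..2 * pi}"

definition torus_measure :: "(real \<times> real) measure" where
  "torus_measure = circle_measure \<Otimes>\<^sub>M circle_measure"

lemma finite_measure_circle: "finite_measure circle_measure"
  by (intro finite_measureI) (simp add: circle_measure_def emeasure_restrict_space)

interpretation circle: finite_measure circle_measure
  by (rule finite_measure_circle)

interpretation circle2: pair_sigma_finite circle_measure circle_measure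
  by unfold_locales

lemma finite_measure_torus: "finite_measure torus_measure"
  unfolding torus_measure_def
  by (rule finite_measure_pair_measure) (rule finite_measure_circle)+

interpretation torus: finite_measure torus_measure
  by (rule finite_measure_torus)

lemma measure_torus: "measure torus_measure (space torus_measure) = (2 * pi)\<^sup>2"
proof -
  have sets_circle: "{0..2 * pi} \<in> sets circle_measure"
    by (simp add: circle_measure_def sets_restrict_space_iff)
  have 1: "measure circle_measure {0..2 * pi} = 2 * pi"
    by (simp add: circle_measure_def measure_restrict_space)
  have "measure torus_measure ({0..2 * pi} \<times> {0..2 * pi}) = (2 * pi)\<^sup>2"
    unfolding torus_measure_def
    using 1 circle.emeasure_pair_measure_Times[of "{0..2 * pi}" circle_measure "{0..2 * pi}"]
    by (simp add: measure_def enn2real_mult power2_eq_square sets_circle)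
  then show ?thesis
    by (simp add: torus_measure_def space_pair_measure circle_measure_def)
qed

text \<open>
  If \<open>V\<close> is a primitive of \<open>v\<close>, the integral is \<open>(V (w + 2 \<pi> \<i>) - V w) / \<i>\<close>, whose derivative in \<open>w\<close>
  vanishes by periodicity.
\<close>

lemma circle_measure_mean_eq:
  fixes v :: "complex \<Rightarrow> complex"
  assumes S: "convex S" "open S" "\<And>w x. w \<in> S \<Longrightarrow> w + \<i> * of_real x \<in> S"
    and v: "v holomorphic_on S" "\<And>w. w \<in> S \<Longrightarrow> v (w + \<i> * of_real (2 * pi)) = v w"
    and w: "w \<in> S" "w' \<in> S"
  shows "(LINT x|circle_measure. v (w + \<i> * of_real x)) = (LINT x|circle_measure. v (w' + \<i> * of_real x))"
proof -
  obtain V where V: "\<And>w. w \<in> S \<Longrightarrow> (V has_field_derivative v w) (at w within S)"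
    using holomorphic_convex_primitive'[OF S(1,2) v(1)] by blast
  then have V: "(V has_field_derivative v w) (at w)" if "w \<in> S" for w
    using that S(2) by (metis at_within_open)
  define G where "G = (\<lambda>w. V (w + \<i> * of_real (2 * pi)) - V w)"
  have "(G has_field_derivative 0) (at w within S)" if w: "w \<in> S" for w
  proof -
    have "((\<lambda>w. V (w + \<i> * of_real (2 * pi))) has_field_derivative v (w + \<i> * of_real (2 * pi))) (at w)"
      using DERIV_shift V S(3) w by blast
    then have "(G has_field_derivative v (w + \<i> * of_real (2 * pi)) - v w) (at w)"
      unfolding G_def by (intro DERIV_diff V w)
    then show ?thesis
      using v(2)[OF w] by (metis has_field_derivative_at_within diff_self)
  qed
  then obtain c where c: "\<And>w. w \<in> S \<Longrightarrow> G w = c"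
    using has_field_derivative_zero_constant[OF S(1)] by metis
  have int: "(LINT x|circle_measure. v (u + \<i> * of_real x)) = G u / \<i>" if u: "u \<in> S" for u
  proof -
    have "(LINT x|lborel. indicator {0..2 * pi} x *\<^sub>R v (u + \<i> * of_real x))
        = V (u + \<i> * of_real (2 * pi)) / \<i> - V (u + \<i> * of_real 0) / \<i>"
    proof (rule integral_FTC_Icc)
      show "((\<lambda>x. V (u + \<i> * of_real x) / \<i>) has_vector_derivative v (u + \<i> * of_real x))
          (at x within {0..2 * pi})" for x
      proof -
        have "((\<lambda>z. V (u + \<i> * z) / \<i>) has_field_derivative v (u + \<i> * of_real x)) (at (of_real x))"
          using V[OF S(3)[OF u, of x]]
          by (auto intro!: derivative_eq_intros DERIV_chain2[where g = "\<lambda>z. u + \<i> * z" and f = V] simp: mult.assoc)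
        then show ?thesis
          using has_vector_derivative_at_within has_vector_derivative_real_field by blast
      qed
      show "continuous_on {0..2 * pi} (\<lambda>x. v (u + \<i> * of_real x))"
        by (rule continuous_on_compose2[OF holomorphic_on_imp_continuous_on[OF v(1)]])
           (use S(3) u in \<open>auto intro!: continuous_intros\<close>)
    qed simp
    then show ?thesis
      by (simp add: circle_measure_def integral_restrict_space G_def algebra_simps)
  qed
  show ?thesis
    using w by (simp add: int c)
qed

lemma measurable_torus_borel [measurable]: "(\<lambda>\<theta>. \<theta>) \<in> torus_measure \<rightarrow>\<^sub>M borel"
proof -
  have 1: "(\<lambda>x. x) \<in> circle_measure \<rightarrow>\<^sub>M borel"
    unfolding circle_measure_def by (rule measurable_restrict_space1) simp
  have "(\<lambda>\<theta>. (fst \<theta>, snd \<theta>)) \<in> torus_measure \<rightarrow>\<^sub>M borel \<Otimes>\<^sub>M borel"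
    unfolding torus_measure_def
    by (intro measurable_Pair measurable_compose[OF measurable_fst 1] measurable_compose[OF measurable_snd 1])
  then show ?thesis
    by (simp add: borel_prod)
qed

lemma integrable_torus_continuous:
  fixes H :: "real \<times> real \<Rightarrow> complex"
  assumes H: "continuous_on UNIV H"
  shows "integrable torus_measure H"
proof -
  have "compact (H ` ({0..2 * pi} \<times> {0..2 * pi}))"
    using H by (intro compact_continuous_image compact_Times) (auto intro: continuous_on_subset)
  then obtain B where B: "\<And>\<theta>. \<theta> \<in> {0..2 * pi} \<times> {0..2 * pi} \<Longrightarrow> norm (H \<theta>) \<le> B"
    by (metis (no_types, lifting) bounded_iff compact_imp_bounded image_eqI)
  have "space torus_measure = {0..2 * pi} \<times> {0..2 * pi}"
    by (simp add: torus_measure_def space_pair_measure circle_measure_def)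
  moreover have "H \<in> borel_measurable torus_measure"
    using measurable_compose[OF measurable_torus_borel borel_measurable_continuous_onI[OF H]] .
  ultimately show ?thesis
    by (intro torus.integrable_const_bound[where B = B] AE_I2) (use B in auto)
qed

text \<open>
  The preimage of \<open>hartogs \<gamma>\<close> without \<open>z\<^sub>1 = 0\<close> under \<open>exp \<times> exp\<close>. Its slices are convex, so
  that primitives exist.
\<close>

definition log_tube :: "real \<Rightarrow> (complex \<times> complex) set" where
  "log_tube \<gamma> = {(w\<^sub>1, w\<^sub>2). \<gamma> * Re w\<^sub>1 < Re w\<^sub>2 \<and> Re w\<^sub>2 < 0}"

text \<open>By Fubini, the mean in one variable can be taken first, and it does not change when that
  variable moves within its slice. Any two points of the tube are joined by moves of one variable at
  a time.\<close>

lemma torus_mean_log_tube: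
  fixes H :: "complex \<times> complex \<Rightarrow> complex"
  assumes \<gamma>: "\<gamma> > 0" and cont: "continuous_on (log_tube \<gamma>) H"
    and hol: "\<And>w\<^sub>1 w\<^sub>2. (w\<^sub>1, w\<^sub>2) \<in> log_tube \<gamma> \<Longrightarrow> (\<lambda>w. H (w, w\<^sub>2)) field_differentiable at w\<^sub>1"
      "\<And>w\<^sub>1 w\<^sub>2. (w\<^sub>1, w\<^sub>2) \<in> log_tube \<gamma> \<Longrightarrow> (\<lambda>w. H (w\<^sub>1, w)) field_differentiable at w\<^sub>2"
    and per: "\<And>w\<^sub>1 w\<^sub>2. H (w\<^sub>1 + \<i> * of_real (2 * pi), w\<^sub>2) = H (w\<^sub>1, w\<^sub>2)"
      "\<And>w\<^sub>1 w\<^sub>2. H (w\<^sub>1, w\<^sub>2 + \<i> * of_real (2 * pi)) = H (w\<^sub>1, w\<^sub>2)"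
  obtains C where "\<And>w\<^sub>1 w\<^sub>2. (w\<^sub>1, w\<^sub>2) \<in> log_tube \<gamma> \<Longrightarrow>
    (LINT \<theta>|torus_measure. H (w\<^sub>1 + \<i> * of_real (fst \<theta>), w\<^sub>2 + \<i> * of_real (snd \<theta>))) = C"
proof -
  define J where "J = (\<lambda>w\<^sub>1 w\<^sub>2. LINT \<theta>|torus_measure. H (w\<^sub>1 + \<i> * of_real (fst \<theta>), w\<^sub>2 + \<i> * of_real (snd \<theta>)))"
  have int: "integrable (circle_measure \<Otimes>\<^sub>M circle_measure) (\<lambda>(x, y). H (w\<^sub>1 + \<i> * of_real x, w\<^sub>2 + \<i> * of_real y))"
    if "(w\<^sub>1, w\<^sub>2) \<in> log_tube \<gamma>" for w\<^sub>1 w\<^sub>2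
    unfolding torus_measure_def[symmetric] case_prod_beta
    by (intro integrable_torus_continuous continuous_on_compose2[OF cont])
       (use that in \<open>auto intro!: continuous_intros simp: log_tube_def\<close>)
  have 1: "J w\<^sub>1 w\<^sub>2 = J w\<^sub>1' w\<^sub>2" if w: "(w\<^sub>1, w\<^sub>2) \<in> log_tube \<gamma>" "(w\<^sub>1', w\<^sub>2) \<in> log_tube \<gamma>" for w\<^sub>1 w\<^sub>1' w\<^sub>2
  proof -
    let ?S = "{w. Re w < Re w\<^sub>2 / \<gamma>}"
    have S: "w \<in> ?S \<longleftrightarrow> (w, w\<^sub>2 + \<i> * of_real y) \<in> log_tube \<gamma>" for w y
      using w \<gamma> by (auto simp: log_tube_def field_simps)
    have "(LINT x|circle_measure. H (w\<^sub>1 + \<i> * of_real x, w\<^sub>2 + \<i> * of_real y))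
        = (LINT x|circle_measure. H (w\<^sub>1' + \<i> * of_real x, w\<^sub>2 + \<i> * of_real y))" for y
    proof (rule circle_measure_mean_eq[where S = ?S])
      show "(\<lambda>w. H (w, w\<^sub>2 + \<i> * complex_of_real y)) holomorphic_on ?S"
        using hol(1) S by (auto simp: holomorphic_on_def intro: field_differentiable_at_within)
      show "convex ?S" "open ?S"
        by (rule convex_halfspace_Re_lt open_halfspace_Re_lt)+
    qed (use w \<gamma> in \<open>simp_all only: per S\<close>, auto simp: log_tube_def field_simps)
    then show ?thesis
      using circle2.integral_snd[OF int[OF w(1)]] circle2.integral_snd[OF int[OF w(2)]]
      by (simp add: J_def torus_measure_def case_prod_unfold)
  qed
  have 2: "J w\<^sub>1 w\<^sub>2 = J w\<^sub>1 w\<^sub>2'" if w: "(w\<^sub>1, w\<^sub>2) \<in> log_tube \<gamma>" "(w\<^sub>1, w\<^sub>2') \<in> log_tube \<gamma>" for w\<^sub>1 w\<^sub>2 w\<^sub>2'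
  proof -
    \<comment> \<open>The slice depends on the real part of the fixed variable only, so one convex
      set serves for all angles \<open>x\<close>.\<close>
    let ?S = "{w. \<gamma> * Re w\<^sub>1 < Re w} \<inter> {w. Re w < 0}"
    have S: "w \<in> ?S \<longleftrightarrow> (w\<^sub>1 + \<i> * of_real x, w) \<in> log_tube \<gamma>" for w x
      using w \<gamma> by (auto simp: log_tube_def field_simps)
    have "(LINT y|circle_measure. H (w\<^sub>1 + \<i> * of_real x, w\<^sub>2 + \<i> * of_real y))
        = (LINT y|circle_measure. H (w\<^sub>1 + \<i> * of_real x, w\<^sub>2' + \<i> * of_real y))" for x
    proof (rule circle_measure_mean_eq[where S = ?S])
      show "(\<lambda>w. H (w\<^sub>1 + \<i> * complex_of_real x, w)) holomorphic_on ?S"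
        using hol(2) S unfolding holomorphic_on_def by (blast intro: field_differentiable_at_within)
      show "convex ?S" "open ?S"
        by (intro convex_Int convex_halfspace_Re_lt convex_halfspace_Re_gt open_Int open_halfspace_Re_lt open_halfspace_Re_gt)+
    qed (use w in \<open>simp_all only: per\<close>, auto simp: log_tube_def)
    then show ?thesis
      using circle2.integral_fst[OF int[OF w(1)]] circle2.integral_fst[OF int[OF w(2)]]
      by (simp add: J_def torus_measure_def case_prod_unfold)
  qed
  have "J w\<^sub>1 w\<^sub>2 = J (- of_real (2 / \<gamma>)) (-1)" if w: "(w\<^sub>1, w\<^sub>2) \<in> log_tube \<gamma>" for w\<^sub>1 w\<^sub>2
  proof -
    \<comment> \<open>Moving straight to second coordinate -1 may leave the tube, and so may moving
      straight to first coordinate \<open>- 2 / \<gamma>\<close>. Raising \<open>w\<^sub>2\<close>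
      to real part at least -1 first keeps \<open>\<gamma> * Re w\<^sub>1\<close> below it and makes
      room for the move to \<open>- 2 / \<gamma>\<close>, since -2 < -1.\<close>
    define u where "u = complex_of_real (max (-1) (Re w\<^sub>2))"
    have u: "(w\<^sub>1, u) \<in> log_tube \<gamma>" "(- of_real (2 / \<gamma>), u) \<in> log_tube \<gamma>"
        "(- of_real (2 / \<gamma>), -1) \<in> log_tube \<gamma>"
      using w \<gamma> by (auto simp: u_def log_tube_def)
    show ?thesis
      using 2[OF w u(1)] 1[OF u(1,2)] 2[OF u(2,3)] by simp
  qed
  then show thesis
    by (intro that) (simp add: J_def)
qed

text \<open>In logarithmic coordinates \<open>h\<close> times
  \<open>z\<^sub>2\<^sup>k / z\<^sub>1\<^sup>a\<close> is holomorphic and periodic, so its mean is a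
  constant \<open>C\<close>; dividing the factor out again leaves the monomial. Up to the total mass
  of the torus, \<open>C\<close> is a Laurent coefficient of \<open>h\<close>.\<close>

lemma torus_mean_holomorphic2:
  fixes a k :: nat
  assumes \<gamma>: "\<gamma> > 0" and h: "holomorphic2_on h (hartogs \<gamma>)"
  obtains C where "\<And>z. z \<in> hartogs \<gamma> \<Longrightarrow> fst z \<noteq> 0 \<Longrightarrow>
    (LINT \<theta>|torus_measure. h (rot \<theta> z) * cis (real k * snd \<theta> - real a * fst \<theta>)) = C * (fst z ^ a / snd z ^ k)"
proof -
  define H where "H = (\<lambda>(w\<^sub>1, w\<^sub>2). h (exp w\<^sub>1, exp w\<^sub>2) * exp (of_nat k * w\<^sub>2 - of_nat a * w\<^sub>1))"
  have tube: "(exp w\<^sub>1, exp w\<^sub>2) \<in> hartogs \<gamma>" if "(w\<^sub>1, w\<^sub>2) \<in> log_tube \<gamma>" for w\<^sub>1 w\<^sub>2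
    using that by (simp add: hartogs_def log_tube_def powr_def)
  note part = holomorphic2_on_partial[OF h open_hartogs[OF \<gamma>]]
  have contH: "continuous_on (log_tube \<gamma>) H"
    unfolding H_def case_prod_beta
    by (intro continuous_intros continuous_on_compose2[OF holomorphic2_on_imp_continuous_on[OF h]])
       (use tube in auto)
  have hol1: "(\<lambda>w. H (w, w\<^sub>2)) field_differentiable at w\<^sub>1" if "(w\<^sub>1, w\<^sub>2) \<in> log_tube \<gamma>" for w\<^sub>1 w\<^sub>2
  proof -
    have "(\<lambda>w. h (w, exp w\<^sub>2)) \<circ> exp field_differentiable at w\<^sub>1"
      by (intro field_differentiable_compose part(1) tube that field_differentiable_within_exp)
    then show ?thesis
      unfolding H_def comp_def case_prod_conv
      by (intro field_differentiable_mult) (auto intro!: derivative_eq_intros simp: field_differentiable_def)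
  qed
  have hol2: "(\<lambda>w. H (w\<^sub>1, w)) field_differentiable at w\<^sub>2" if "(w\<^sub>1, w\<^sub>2) \<in> log_tube \<gamma>" for w\<^sub>1 w\<^sub>2
  proof -
    have "(\<lambda>w. h (exp w\<^sub>1, w)) \<circ> exp field_differentiable at w\<^sub>2"
      by (intro field_differentiable_compose part(2) tube that field_differentiable_within_exp)
    then show ?thesis
      unfolding H_def comp_def case_prod_conv
      by (intro field_differentiable_mult) (auto intro!: derivative_eq_intros simp: field_differentiable_def)
  qed
  \<comment> \<open>Integrality of \<open>a\<close> and \<open>k\<close> enters here: it makes the
    exponential factor of \<open>H\<close> periodic.\<close>
  define p where "p = \<i> * complex_of_real (2 * pi)"
  have e1: "exp p = 1"
    unfolding p_def cis_conv_exp[symmetric] by simp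
  then have e: "exp (of_nat n * p) = 1" for n :: nat
    by (simp only: exp_of_nat_mult power_one)
  have per1: "H (w\<^sub>1 + \<i> * of_real (2 * pi), w\<^sub>2) = H (w\<^sub>1, w\<^sub>2)"
    and per2: "H (w\<^sub>1, w\<^sub>2 + \<i> * of_real (2 * pi)) = H (w\<^sub>1, w\<^sub>2)" for w\<^sub>1 w\<^sub>2
    unfolding H_def p_def[symmetric] by (simp_all add: exp_add exp_diff distrib_left e e1)
  obtain C where C: "\<And>w\<^sub>1 w\<^sub>2. (w\<^sub>1, w\<^sub>2) \<in> log_tube \<gamma> \<Longrightarrow>
    (LINT \<theta>|torus_measure. H (w\<^sub>1 + \<i> * of_real (fst \<theta>), w\<^sub>2 + \<i> * of_real (snd \<theta>))) = C"
    using torus_mean_log_tube[OF \<gamma> contH hol1 hol2 per1 per2] by blast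
  show thesis
  proof (rule that)
    fix z assume z: "z \<in> hartogs \<gamma>" "fst z \<noteq> 0"
    have z2: "snd z \<noteq> 0"
      using z by (auto simp: hartogs_def)
    have "ln (cmod (fst z) powr \<gamma>) < ln (cmod (snd z))"
      using z z2 by (subst ln_less_cancel_iff) (auto simp: hartogs_def)
    then have "\<gamma> * ln (cmod (fst z)) < ln (cmod (snd z))"
      by (simp add: ln_powr)
    then have t: "(Ln (fst z), Ln (snd z)) \<in> log_tube \<gamma>"
      using z z2 by (auto simp: log_tube_def hartogs_def)
    have "H (Ln (fst z) + \<i> * of_real (fst \<theta>), Ln (snd z) + \<i> * of_real (snd \<theta>))
        = (snd z ^ k / fst z ^ a) * (h (rot \<theta> z) * cis (real k * snd \<theta> - real a * fst \<theta>))" for \<theta>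
    proof -
      have "exp (of_nat k * (Ln (snd z) + \<i> * of_real (snd \<theta>)) - of_nat a * (Ln (fst z) + \<i> * of_real (fst \<theta>)))
          = exp (of_nat k * Ln (snd z)) / exp (of_nat a * Ln (fst z)) * cis (real k * snd \<theta> - real a * fst \<theta>)"
      proof -
        have "of_nat k * (Ln (snd z) + \<i> * of_real (snd \<theta>)) - of_nat a * (Ln (fst z) + \<i> * of_real (fst \<theta>))
            = (of_nat k * Ln (snd z) - of_nat a * Ln (fst z)) + \<i> * of_real (real k * snd \<theta> - real a * fst \<theta>)"
          by (simp add: algebra_simps)
        then show ?thesis
          by (simp only: exp_add exp_diff cis_conv_exp)
      qed
      also have "\<dots> = snd z ^ k / fst z ^ a * cis (real k * snd \<theta> - real a * fst \<theta>)"
        using z z2 by (simp add: exp_of_nat_mult)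
      finally show ?thesis
        using z z2 by (simp add: H_def rot_def exp_add cis_conv_exp mult_ac)
    qed
    then have "C = (snd z ^ k / fst z ^ a) * (LINT \<theta>|torus_measure. h (rot \<theta> z) * cis (real k * snd \<theta> - real a * fst \<theta>))"
      using C[OF t] by simp
    then show "(LINT \<theta>|torus_measure. h (rot \<theta> z) * cis (real k * snd \<theta> - real a * fst \<theta>)) = C * (fst z ^ a / snd z ^ k)"
      using z z2 by simp
  qed
qed

subsection \<open>The Bergman projection\<close>

lemma hartogs_norm_less:
  assumes "\<gamma> > 0" "z \<in> hartogs \<gamma>"
  shows "cmod (fst z) < 1" "cmod (snd z) < 1" "snd z \<noteq> 0"
proof -
  have 1: "cmod (fst z) powr \<gamma> < cmod (snd z)" "cmod (snd z) < 1"
    using assms by (auto simp: hartogs_def)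
  then show "cmod (snd z) < 1" "snd z \<noteq> 0"
    by (auto simp: not_less)
  show "cmod (fst z) < 1"
  proof (rule ccontr)
    assume "\<not> cmod (fst z) < 1"
    then have "1 \<le> cmod (fst z) powr \<gamma>"
      using assms(1) by (intro ge_one_powr_ge_zero) auto
    then show False
      using 1 by simp
  qed
qed

lemma lmeasurable_hartogs:
  assumes "\<gamma> > 0"
  shows "hartogs \<gamma> \<in> lmeasurable"
proof (rule lmeasurable_open)
  have "hartogs \<gamma> \<subseteq> cball 0 1 \<times> cball 0 1"
    using hartogs_norm_less[OF assms] by (fastforce simp: less_imp_le)
  then show "bounded (hartogs \<gamma>)"
    by (rule bounded_subset[rotated]) (intro bounded_Times bounded_cball)
qed (rule open_hartogs[OF assms])

lemma emeasure_hartogs_pos: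
  assumes "\<gamma> > 0"
  shows "emeasure (lebesgue_on (hartogs \<gamma>)) (space (lebesgue_on (hartogs \<gamma>))) \<noteq> 0"
proof
  assume "emeasure (lebesgue_on (hartogs \<gamma>)) (space (lebesgue_on (hartogs \<gamma>))) = 0"
  then have "negligible (hartogs \<gamma>)"
    using lmeasurable_hartogs[OF assms]
    by (auto simp: negligible_iff_null_sets null_sets_def emeasure_restrict_space)
  moreover have "(0, 1 / 2) \<in> hartogs \<gamma>"
    by (simp add: hartogs_def)
  ultimately show False
    using open_not_negligible[OF open_hartogs[OF assms]] by blast
qed

lemma AE_fst_nonzero:
  assumes "S \<in> sets lebesgue"
  shows "AE z in lebesgue_on S. fst (z :: complex \<times> complex) \<noteq> 0"
proof -
  \<comment> \<open>This is the real hyperplane \<open>Re (fst z) = 0\<close>, which contains the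
    complex line \<open>fst z = 0\<close>.\<close>
  have "negligible {z :: complex \<times> complex. (1, 0) \<bullet> z = 0}"
    by (rule negligible_hyperplane) (simp add: zero_prod_def)
  then have "negligible {z :: complex \<times> complex. fst z = 0}"
    by (rule negligible_subset) auto
  then have "AE z in lebesgue. fst (z :: complex \<times> complex) \<noteq> 0"
    by (intro AE_I'[where N = "{z. fst z = 0}"]) (auto simp: negligible_iff_null_sets)
  then show ?thesis
    using assms by (subst AE_restrict_space_iff) auto
qed

lemma borel_measurable_cnj [measurable]:
  assumes "f \<in> borel_measurable M"
  shows "(\<lambda>x. cnj (f x)) \<in> borel_measurable M"
  using assms by (rule measurable_compose) (intro borel_measurable_continuous_onI continuous_intros)

lemma L2_mult_cnj_integrable:
  fixes f g :: "'a \<Rightarrow> complex"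
  assumes [measurable]: "f \<in> borel_measurable M" "g \<in> borel_measurable M"
    and "integrable M (\<lambda>z. cmod (f z) powr 2)" "integrable M (\<lambda>z. cmod (g z) powr 2)"
  shows "integrable M (\<lambda>z. f z * cnj (g z))"
proof (rule Bochner_Integration.integrable_bound)
  show "integrable M (\<lambda>z. cmod (f z) powr 2 + cmod (g z) powr 2)"
    using assms by simp
  have "cmod x * cmod y \<le> (cmod x)\<^sup>2 + (cmod y)\<^sup>2" for x y
    using sum_squares_bound[of "cmod x" "cmod y"] mult_nonneg_nonneg[OF norm_ge_zero[of x] norm_ge_zero[of y]]
    unfolding mult.assoc by linarith
  then show "AE z in M. norm (f z * cnj (g z)) \<le> norm (cmod (f z) powr 2 + cmod (g z) powr 2)"
    by (intro AE_I2) (simp add: norm_mult)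
qed simp

lemma Lp_on_2_diff:
  assumes "f \<in> Lp_on \<Omega> 2" "g \<in> Lp_on \<Omega> 2"
  shows "(\<lambda>z. f z - g z) \<in> Lp_on \<Omega> 2"
proof -
  have [measurable]: "f \<in> borel_measurable (lebesgue_on \<Omega>)" "g \<in> borel_measurable (lebesgue_on \<Omega>)"
    and int: "integrable (lebesgue_on \<Omega>) (\<lambda>z. cmod (f z) powr 2)" "integrable (lebesgue_on \<Omega>) (\<lambda>z. cmod (g z) powr 2)"
    using assms by (auto simp: Lp_on_def)
  have "integrable (lebesgue_on \<Omega>) (\<lambda>z. cmod (f z - g z) powr 2)"
  proof (rule Bochner_Integration.integrable_bound)
    show "integrable (lebesgue_on \<Omega>) (\<lambda>z. 2 * (cmod (f z) powr 2 + cmod (g z) powr 2))"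
      using int by simp
    have "(cmod (x - y))\<^sup>2 \<le> 2 * ((cmod x)\<^sup>2 + (cmod y)\<^sup>2)" for x y
    proof -
      have "(cmod (x - y))\<^sup>2 \<le> (cmod x + cmod y)\<^sup>2"
        by (intro power_mono norm_triangle_ineq4) simp
      also have "\<dots> \<le> 2 * ((cmod x)\<^sup>2 + (cmod y)\<^sup>2)"
        using sum_squares_bound[of "cmod x" "cmod y"] by (simp add: power2_sum)
      finally show ?thesis .
    qed
    then show "AE z in lebesgue_on \<Omega>. norm (cmod (f z - g z) powr 2) \<le> norm (2 * (cmod (f z) powr 2 + cmod (g z) powr 2))"
      by (intro AE_I2) simp
  qed measurable
  then show ?thesis
    by (simp add: Lp_on_def)
qed

lemma L2_inner_diff_left:
  assumes "f \<in> Lp_on \<Omega> 2" "g \<in> Lp_on \<Omega> 2" "h \<in> Lp_on \<Omega> 2"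
  shows "L2_inner \<Omega> (\<lambda>z. f z - g z) h = L2_inner \<Omega> f h - L2_inner \<Omega> g h"
  using assms unfolding L2_inner_def left_diff_distrib
  by (intro Bochner_Integration.integral_diff L2_mult_cnj_integrable) (auto simp: Lp_on_def)

lemma holomorphic2_on_diff:
  assumes "holomorphic2_on f \<Omega>" "holomorphic2_on g \<Omega>"
  shows "holomorphic2_on (\<lambda>z. f z - g z) \<Omega>"
  unfolding holomorphic2_on_def
proof
  fix z assume "z \<in> \<Omega>"
  then obtain a b a' b' where
    "(f has_derivative (\<lambda>(h\<^sub>1, h\<^sub>2). a * h\<^sub>1 + b * h\<^sub>2)) (at z within \<Omega>)"
    "(g has_derivative (\<lambda>(h\<^sub>1, h\<^sub>2). a' * h\<^sub>1 + b' * h\<^sub>2)) (at z within \<Omega>)"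
    using assms unfolding holomorphic2_on_def by meson
  then have "((\<lambda>z. f z - g z) has_derivative
      (\<lambda>h. (\<lambda>(h\<^sub>1, h\<^sub>2). a * h\<^sub>1 + b * h\<^sub>2) h - (\<lambda>(h\<^sub>1, h\<^sub>2). a' * h\<^sub>1 + b' * h\<^sub>2) h)) (at z within \<Omega>)"
    by (rule has_derivative_diff)
  moreover have "(\<lambda>h. (\<lambda>(h\<^sub>1, h\<^sub>2). a * h\<^sub>1 + b * h\<^sub>2) h - (\<lambda>(h\<^sub>1, h\<^sub>2). a' * h\<^sub>1 + b' * h\<^sub>2) h)
      = (\<lambda>(h\<^sub>1, h\<^sub>2). (a - a') * h\<^sub>1 + (b - b') * h\<^sub>2)"
    by (auto simp: algebra_simps)
  ultimately show "\<exists>a b. ((\<lambda>z. f z - g z) has_derivative (\<lambda>(h\<^sub>1, h\<^sub>2). a * h\<^sub>1 + b * h\<^sub>2)) (at z within \<Omega>)"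
    by metis
qed

text \<open>A zero norm gives vanishing almost everywhere only. By continuity the set where
  \<open>d\<close> is nonzero is open, and an open negligible set is empty, so \<open>d\<close>
  vanishes at every point.\<close>

lemma L2_inner_self_eq_0:
  assumes "open \<Omega>" and d: "d \<in> Ap_on \<Omega> 2" and "L2_inner \<Omega> d d = 0" and "z \<in> \<Omega>"
  shows "d z = 0"
proof -
  have [measurable]: "d \<in> borel_measurable (lebesgue_on \<Omega>)"
    and int: "integrable (lebesgue_on \<Omega>) (\<lambda>z. (cmod (d z))\<^sup>2)"
    and cont: "continuous_on \<Omega> d"
    using d by (auto simp: Ap_on_def Lp_on_def holomorphic2_on_imp_continuous_on)
  have "L2_inner \<Omega> d d = (LINT z|lebesgue_on \<Omega>. complex_of_real ((cmod (d z))\<^sup>2))"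
    by (simp only: L2_inner_def complex_norm_square)
  then have "(LINT z|lebesgue_on \<Omega>. (cmod (d z))\<^sup>2) = 0"
    using assms(3) by (metis integral_complex_of_real of_real_eq_0_iff)
  then have "AE z in lebesgue_on \<Omega>. (cmod (d z))\<^sup>2 = 0"
    using int by (subst (asm) integral_nonneg_eq_0_iff_AE) auto
  then have "AE z in lebesgue. z \<in> \<Omega> \<longrightarrow> d z = 0"
    using \<open>open \<Omega>\<close> by (subst (asm) AE_restrict_space_iff) auto
  then obtain N where N: "N \<in> null_sets lebesgue" "{z \<in> \<Omega>. d z \<noteq> 0} \<subseteq> N"
    by (auto simp: eventually_ae_filter)
  then have "negligible {z \<in> \<Omega>. d z \<noteq> 0}"
    using negligible_iff_null_sets negligible_subset by blast
  moreover have "open {z \<in> \<Omega>. d z \<noteq> 0}"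
  proof -
    have "{z \<in> \<Omega>. d z \<noteq> 0} = \<Omega> \<inter> d -` (- {0})"
      by auto
    then show ?thesis
      using continuous_open_preimage[OF cont \<open>open \<Omega>\<close> open_Compl[OF closed_singleton]] by simp
  qed
  ultimately show ?thesis
    using open_not_negligible \<open>z \<in> \<Omega>\<close> by blast
qed

text \<open>The difference of two candidates lies in A^2 and is orthogonal to itself. Exhibiting one
  candidate thus settles the definite description, without a general existence theorem for
  projections.\<close>

lemma bergman_projection_eqI:
  assumes \<Omega>: "open \<Omega>" and f: "f \<in> Lp_on \<Omega> 2" and g: "g \<in> Ap_on \<Omega> 2" "\<And>z. z \<notin> \<Omega> \<Longrightarrow> g z = 0"
    and orth: "\<And>h. h \<in> Ap_on \<Omega> 2 \<Longrightarrow> L2_inner \<Omega> (\<lambda>z. f z - g z) h = 0"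
  shows "bergman_projection \<Omega> f = g"
  unfolding bergman_projection_def
proof (rule the_equality)
  fix g' assume g': "g' \<in> Ap_on \<Omega> 2 \<and> (\<forall>z. z \<notin> \<Omega> \<longrightarrow> g' z = 0) \<and>
    (\<forall>h\<in>Ap_on \<Omega> 2. L2_inner \<Omega> (\<lambda>z. f z - g' z) h = 0)"
  define d where "d = (\<lambda>z. g' z - g z)"
  have Lp: "g \<in> Lp_on \<Omega> 2" "g' \<in> Lp_on \<Omega> 2"
    using g g' by (auto simp: Ap_on_def)
  have d: "d \<in> Ap_on \<Omega> 2"
    using g g' unfolding d_def by (auto simp: Ap_on_def intro!: Lp_on_2_diff holomorphic2_on_diff)
  then have dLp: "d \<in> Lp_on \<Omega> 2"
    by (simp add: Ap_on_def)
  have "L2_inner \<Omega> (\<lambda>z. f z - g z) d - L2_inner \<Omega> (\<lambda>z. f z - g' z) d = L2_inner \<Omega> d d"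
    using L2_inner_diff_left[OF f Lp(1) dLp] L2_inner_diff_left[OF f Lp(2) dLp]
      L2_inner_diff_left[OF Lp(2,1) dLp] by (simp add: d_def)
  then have "L2_inner \<Omega> d d = 0"
    using orth d g' by simp
  then have "d z = 0" if "z \<in> \<Omega>" for z
    using L2_inner_self_eq_0[OF \<Omega> d] that by blast
  then show "g' = g"
    using g(2) g' unfolding d_def by (metis ext right_minus_eq)
qed (use assms in auto)

text \<open>The exponent \<open>k\<close> is a pole order in the second variable. The first exponent
  is nonnegative because the triangle contains points with \<open>fst z = 0\<close>.\<close>

definition monomial2 :: "nat \<Rightarrow> nat \<Rightarrow> complex \<times> complex \<Rightarrow> complex" where
  "monomial2 a k z = fst z ^ a / snd z ^ k"

lemma monomial2_borel [measurable]: "monomial2 a k \<in> borel_measurable borel"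
proof -
  have "fst \<in> borel_measurable (borel :: (complex \<times> complex) measure)" "snd \<in> borel_measurable (borel :: (complex \<times> complex) measure)"
    by (intro borel_measurable_continuous_onI continuous_intros)+
  then show ?thesis
    unfolding monomial2_def[abs_def] by (intro borel_measurable_divide borel_measurable_power) auto
qed

text \<open>Rotating \<open>F\<close> and \<open>h\<close> together does not change their inner
  product, so it may be averaged over the torus. Covariance turns the rotation of \<open>F\<close>
  into a character, and the mean of \<open>h\<close> against that character is a multiple of
  \<open>monomial2 a k\<close>. Hence the inner product with \<open>h\<close> is a multiple of the
  one with the monomial.\<close>

lemma L2_inner_covariant_eq_0:
  assumes \<gamma>: "\<gamma> > 0" and F: "F \<in> Lp_on (hartogs \<gamma>) 2"
    and cov: "\<And>\<theta> z. z \<in> hartogs \<gamma> \<Longrightarrow> F (rot \<theta> z) = cis (real a * fst \<theta> - real k * snd \<theta>) * F z"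
    and h: "h \<in> Ap_on (hartogs \<gamma>) 2"
    and orth: "L2_inner (hartogs \<gamma>) F (monomial2 a k) = 0"
  shows "L2_inner (hartogs \<gamma>) F h = 0"
proof -
  let ?\<Omega> = "hartogs \<gamma>"
  define N where "N = lebesgue_on ?\<Omega>"
  define \<xi> where "\<xi> = (\<lambda>\<theta>. cis (real a * fst \<theta> - real k * snd \<theta>))"
  have hol: "holomorphic2_on h ?\<Omega>"
    using h by (simp add: Ap_on_def)
  have \<Omega>: "?\<Omega> \<in> sets lebesgue"
    using open_hartogs[OF \<gamma>] by simp
  interpret N: finite_measure N
    unfolding N_def by (rule finite_measure_lebesgue_on[OF lmeasurable_hartogs[OF \<gamma>]])
  interpret pair_sigma_finite torus_measure N
    by unfold_locales
  have spN: "space N = ?\<Omega>"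
    by (simp add: N_def)
  have rotN: "rot \<theta> \<in> N \<rightarrow>\<^sub>M N" and distrN: "distr N N (rot \<theta>) = N" for \<theta>
    unfolding N_def
    by (rule rot_measurable_lebesgue_on[OF \<Omega> rot_in_hartogs_iff], rule distr_lebesgue_on_rot[OF \<Omega> rot_in_hartogs_iff])
  \<comment> \<open>Extension by zero makes \<open>h\<close> Borel on the whole space, so that its
    composition with the rotation is jointly measurable in angle and point.\<close>
  define h0 where "h0 = (\<lambda>z. if z \<in> ?\<Omega> then h z else 0)"
  have h0: "h0 \<in> borel_measurable borel"
    unfolding h0_def using open_hartogs[OF \<gamma>] holomorphic2_on_imp_continuous_on[OF hol]
    by (intro borel_measurable_continuous_on_if) auto
  have FN: "F \<in> borel_measurable N"
    using F by (simp add: Lp_on_def N_def)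
  define P where "P = (\<lambda>z. F z * cnj (h z))"
  have P: "integrable N P"
    using F h unfolding P_def N_def by (intro L2_mult_cnj_integrable) (auto simp: Lp_on_def Ap_on_def)
  \<comment> \<open>The rotated integrand \<open>P (rot \<theta> z)\<close>, rewritten by covariance
    so that the merely Lebesgue measurable \<open>F\<close> is evaluated at \<open>z\<close> and not
    at the rotated point.\<close>
  define K where "K = (\<lambda>\<theta> z. F z * cnj (h0 (rot \<theta> z)) * \<xi> \<theta>)"
  have KP: "K \<theta> z = P (rot \<theta> z)" if "z \<in> space N" for \<theta> z
    using that cov[of z \<theta>] by (simp add: K_def P_def h0_def spN rot_in_hartogs_iff \<xi>_def mult_ac)
  have intP: "integrable N (\<lambda>z. P (rot \<theta> z))" "(LINT z|N. P (rot \<theta> z)) = (LINT z|N. P z)"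
      "(LINT z|N. norm (P (rot \<theta> z))) = (LINT z|N. norm (P z))" for \<theta>
    using integrable_distr[OF rotN[of \<theta>], of P] integral_distr[OF rotN[of \<theta>], of P]
      integral_distr[OF rotN[of \<theta>], of "\<lambda>z. norm (P z)"] P
    by (simp_all add: distrN)
  have intK: "integrable N (K \<theta>)" "(LINT z|N. K \<theta> z) = (LINT z|N. P z)"
      "(LINT z|N. norm (K \<theta> z)) = (LINT z|N. norm (P z))" for \<theta>
    using intP[of \<theta>] by (simp_all add: KP cong: Bochner_Integration.integral_cong Bochner_Integration.integrable_cong)
  have "(\<lambda>p. (fst p, snd p)) \<in> torus_measure \<Otimes>\<^sub>M N \<rightarrow>\<^sub>M borel \<Otimes>\<^sub>M borel"
  proof (intro measurable_Pair measurable_compose[OF measurable_fst measurable_torus_borel] measurable_compose[OF measurable_snd])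
    show "(\<lambda>z. z) \<in> N \<rightarrow>\<^sub>M borel"
      unfolding N_def by (intro measurable_restrict_space1 measurable_completion) simp
  qed
  then have id: "(\<lambda>p. p) \<in> torus_measure \<Otimes>\<^sub>M N \<rightarrow>\<^sub>M borel"
    by (simp add: borel_prod)
  have "(\<lambda>p. rot (fst p) (snd p)) \<in> borel_measurable borel"
    unfolding rot_def cis_conv_exp by (intro borel_measurable_continuous_onI continuous_intros)
  from measurable_compose[OF measurable_compose[OF id this] h0]
  have m1: "(\<lambda>p. h0 (rot (fst p) (snd p))) \<in> borel_measurable (torus_measure \<Otimes>\<^sub>M N)" .
  have m2: "(\<lambda>p. F (snd p)) \<in> borel_measurable (torus_measure \<Otimes>\<^sub>M N)"
    by (rule measurable_compose[OF measurable_snd FN])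
  have "(\<lambda>p :: (real \<times> real) \<times> complex \<times> complex. \<xi> (fst p)) \<in> borel_measurable borel"
    unfolding \<xi>_def cis_conv_exp by (intro borel_measurable_continuous_onI continuous_intros)
  from measurable_compose[OF id this]
  have m3: "(\<lambda>p. \<xi> (fst p)) \<in> borel_measurable (torus_measure \<Otimes>\<^sub>M N)" .
  have m4: "(\<lambda>p. cnj (h0 (rot (fst p) (snd p)))) \<in> borel_measurable (torus_measure \<Otimes>\<^sub>M N)"
    by (rule borel_measurable_cnj[OF m1])
  have "integrable (torus_measure \<Otimes>\<^sub>M N) (case_prod K)"
  proof (rule Fubini_integrable)
    show "case_prod K \<in> borel_measurable (torus_measure \<Otimes>\<^sub>M N)"
      unfolding K_def case_prod_unfold by (intro borel_measurable_times m2 m3 m4)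
  qed (simp_all add: intK torus.integrable_const)
  from Fubini_integral[OF this]
  have "(LINT z|N. LINT \<theta>|torus_measure. K \<theta> z) = (2 * pi)\<^sup>2 *\<^sub>R (LINT z|N. P z)"
    by (simp add: intK measure_torus)
  moreover have "(LINT z|N. LINT \<theta>|torus_measure. K \<theta> z) = 0"
  proof -
    obtain C where C: "\<And>z. z \<in> ?\<Omega> \<Longrightarrow> fst z \<noteq> 0 \<Longrightarrow>
      (LINT \<theta>|torus_measure. h (rot \<theta> z) * cis (real k * snd \<theta> - real a * fst \<theta>)) = C * (fst z ^ a / snd z ^ k)"
      using torus_mean_holomorphic2[OF \<gamma> hol, of k a] by blast
    have K_mean: "(LINT \<theta>|torus_measure. K \<theta> z) = cnj C * (F z * cnj (monomial2 a k z))"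
      if z: "z \<in> ?\<Omega>" "fst z \<noteq> 0" for z
    proof -
      have "K \<theta> z = F z * cnj (h (rot \<theta> z) * cis (real k * snd \<theta> - real a * fst \<theta>))" for \<theta>
        using z by (simp add: K_def h0_def rot_in_hartogs_iff \<xi>_def cis_cnj)
      then have "(LINT \<theta>|torus_measure. K \<theta> z)
          = F z * cnj (LINT \<theta>|torus_measure. h (rot \<theta> z) * cis (real k * snd \<theta> - real a * fst \<theta>))"
        by (simp only: integral_mult_right_zero Bochner_Integration.integral_cnj)
      then show ?thesis
        using C[OF z] by (simp add: monomial2_def mult_ac)
    qed
    have ae: "AE z in N. (LINT \<theta>|torus_measure. K \<theta> z) = cnj C * (F z * cnj (monomial2 a k z))"
      using AE_fst_nonzero[OF \<Omega>, folded N_def] AE_space[of N] by eventually_elim (use K_mean spN in auto)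
    have "(LINT z|N. LINT \<theta>|torus_measure. K \<theta> z) = (LINT z|N. cnj C * (F z * cnj (monomial2 a k z)))"
    proof (rule integral_cong_AE[OF _ _ ae])
      show "(\<lambda>z. LINT \<theta>|torus_measure. K \<theta> z) \<in> borel_measurable N"
        using borel_measurable_integrable[OF integrable_snd[OF \<open>integrable (torus_measure \<Otimes>\<^sub>M N) (case_prod K)\<close>]] .
      have "(\<lambda>z. monomial2 a k z) \<in> borel_measurable N"
        unfolding N_def by (intro measurable_restrict_space1 measurable_completion) simp
      then have "(\<lambda>z. cnj (monomial2 a k z)) \<in> borel_measurable N"
        by (rule borel_measurable_cnj)
      then show "(\<lambda>z. cnj C * (F z * cnj (monomial2 a k z))) \<in> borel_measurable N"
        using FN by (intro borel_measurable_times) auto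
    qed
    then show ?thesis
      using orth by (simp add: L2_inner_def N_def)
  qed
  ultimately show ?thesis
    by (simp add: L2_inner_def N_def P_def)
qed

subsection \<open>Integrability of monomials\<close>

lemma nn_integral_lborel_c2_scale:
  fixes r s :: real and f :: "complex \<times> complex \<Rightarrow> ennreal"
  assumes "r > 0" "s > 0" and f: "f \<in> borel_measurable borel"
  shows "(\<integral>\<^sup>+z. f z \<partial>lborel) = ennreal (r\<^sup>2 * s\<^sup>2) * (\<integral>\<^sup>+z. f (r *\<^sub>R fst z, s *\<^sub>R snd z) \<partial>lborel)"
proof -
  \<comment> \<open>The condition \<open>snd j = 0\<close> singles out the two real basis directions
    of the first factor; each factor \<open>r\<close> or \<open>s\<close> thus occurs twice in the
    determinant.\<close>
  define c :: "complex \<times> complex \<Rightarrow> real" where "c = (\<lambda>j. if snd j = 0 then r else s)"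
  define T :: "complex \<times> complex \<Rightarrow> complex \<times> complex" where "T = (\<lambda>z. (r *\<^sub>R fst z, s *\<^sub>R snd z))"
  have [measurable]: "T \<in> borel_measurable borel"
    unfolding T_def by (intro borel_measurable_continuous_onI continuous_intros)
  have 1: "(0 + (\<Sum>j\<in>Basis. (c j * (z \<bullet> j)) *\<^sub>R j)) = T z" for z
    unfolding Basis_c2 by (simp add: c_def T_def inner_prod_def prod_eq_iff complex_eq_iff)
  have 2: "(\<Prod>j\<in>Basis. \<bar>c j\<bar>) = r\<^sup>2 * s\<^sup>2"
    unfolding Basis_c2 using assms by (simp add: c_def power2_eq_square)
  have "lborel = density (distr lborel borel T) (\<lambda>_. ennreal (r\<^sup>2 * s\<^sup>2))"
    using lborel_affine_euclidean[of c 0] assms unfolding 1 2 by (simp add: c_def)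
  then have "(\<integral>\<^sup>+z. f z \<partial>lborel) = (\<integral>\<^sup>+z. f z \<partial>density (distr lborel borel T) (\<lambda>_. ennreal (r\<^sup>2 * s\<^sup>2)))"
    by (rule arg_cong)
  also have "\<dots> = ennreal (r\<^sup>2 * s\<^sup>2) * (\<integral>\<^sup>+z. f z \<partial>distr lborel borel T)"
    using f by (simp add: nn_integral_density nn_integral_cmult)
  also have "(\<integral>\<^sup>+z. f z \<partial>distr lborel borel T) = (\<integral>\<^sup>+z. f (T z) \<partial>lborel)"
    using f by (simp add: nn_integral_distr)
  finally show ?thesis
    by (simp add: T_def)
qed

lemma hartogs_scale_iff:
  assumes "\<gamma> > 0" "s > 0" "s \<le> 1"
  shows "(s powr (1 / \<gamma>) *\<^sub>R fst z, s *\<^sub>R snd z) \<in> hartogs \<gamma> \<and> cmod (s *\<^sub>R snd z) < s \<longleftrightarrow> z \<in> hartogs \<gamma>"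
proof -
  have "cmod (s powr (1 / \<gamma>) *\<^sub>R fst z) powr \<gamma> = s * cmod (fst z) powr \<gamma>"
    using assms by (simp add: powr_mult powr_powr)
  moreover have "s * cmod (snd z) < 1" if "cmod (snd z) < 1"
    using that assms mult_left_le_one_le[of "cmod (snd z)" s] by simp
  ultimately show ?thesis
    using assms by (cases z) (auto simp: hartogs_def)
qed

text \<open>An extended nonnegative integral, so that divergence is the value infinity. The set
  \<open>R\<close> restricts the modulus of the second variable, so that shells are given by
  intervals.\<close>

definition monomial2_mass :: "real \<Rightarrow> nat \<Rightarrow> nat \<Rightarrow> real \<Rightarrow> real set \<Rightarrow> ennreal" where
  "monomial2_mass \<gamma> a k p R =
     (\<integral>\<^sup>+z. ennreal (cmod (monomial2 a k z) powr p) * indicator {z \<in> hartogs \<gamma>. cmod (snd z) \<in> R} z \<partial>lborel)"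

lemma monomial2_mass_measurable:
  assumes "\<gamma> > 0" "R \<in> sets borel"
  shows "(\<lambda>z. ennreal (cmod (monomial2 a k z) powr p) * indicator {z \<in> hartogs \<gamma>. cmod (snd z) \<in> R} z) \<in> borel_measurable borel"
proof -
  have "(\<lambda>z::complex \<times> complex. cmod (snd z)) \<in> borel_measurable borel"
    by (intro borel_measurable_continuous_onI continuous_intros)
  then have "(\<lambda>z::complex \<times> complex. cmod (snd z)) -` R \<in> sets borel"
    using assms(2) by (rule measurable_sets_borel)
  moreover have "{z \<in> hartogs \<gamma>. cmod (snd z) \<in> R} = hartogs \<gamma> \<inter> (\<lambda>z. cmod (snd z)) -` R"
    by auto
  ultimately have [measurable]: "{z \<in> hartogs \<gamma>. cmod (snd z) \<in> R} \<in> sets borel"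
    using open_hartogs[OF assms(1)] by auto
  show ?thesis
    by measurable
qed

lemma monomial2_mass_Un:
  assumes "\<gamma> > 0" "R \<in> sets borel" "R' \<in> sets borel" "R \<inter> R' = {}"
  shows "monomial2_mass \<gamma> a k p (R \<union> R') = monomial2_mass \<gamma> a k p R + monomial2_mass \<gamma> a k p R'"
  unfolding monomial2_mass_def
  using monomial2_mass_measurable[OF assms(1)] assms(2-4)
  by (subst nn_integral_add[symmetric]) (auto intro!: nn_integral_cong split: split_indicator)

text \<open>
  The map \<open>(z\<^sub>1, z\<^sub>2) \<mapsto> (s\<^sup>1\<^sup>/\<^sup>\<gamma> z\<^sub>1, s z\<^sub>2)\<close> sends the Hartogs triangle onto its part with \<open>\<bar>z\<^sub>2\<bar> < s\<close>. Integrability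
  of a monomial thus amounts to the convergence of a geometric series over dyadic shells.
\<close>

lemma monomial2_mass_scale:
  assumes \<gamma>: "\<gamma> > 0" and s: "s > 0" "s \<le> 1" and R: "R \<in> sets borel" "(\<lambda>r. s * r) -` R \<in> sets borel" "R \<subseteq> {..<s}"
  shows "monomial2_mass \<gamma> a k p R =
    ennreal (s powr ((2 + p * a) / \<gamma> + 2 - p * k)) * monomial2_mass \<gamma> a k p ((\<lambda>r. s * r) -` R)"
proof -
  define q where "q = s powr (1 / \<gamma>)"
  have q: "q > 0"
    using s by (simp add: q_def)
  have ind: "(q *\<^sub>R fst z, s *\<^sub>R snd z) \<in> {z \<in> hartogs \<gamma>. cmod (snd z) \<in> R} \<longleftrightarrow>
      z \<in> {z \<in> hartogs \<gamma>. cmod (snd z) \<in> (\<lambda>r. s * r) -` R}" for z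
    using hartogs_scale_iff[OF \<gamma> s, of z] R(3) s by (auto simp: q_def)
  have mono: "cmod (monomial2 a k (q *\<^sub>R fst z, s *\<^sub>R snd z)) powr p
      = s powr (p * a / \<gamma> - p * k) * cmod (monomial2 a k z) powr p" for z
  proof -
    have "q ^ a / s ^ k = s powr (a / \<gamma> - k)"
      using s by (simp add: q_def powr_realpow[symmetric] powr_powr powr_diff)
    moreover have "cmod (monomial2 a k (q *\<^sub>R fst z, s *\<^sub>R snd z)) = (q ^ a / s ^ k) * cmod (monomial2 a k z)"
      using q s by (simp add: monomial2_def norm_divide norm_power norm_mult power_mult_distrib)
    ultimately show ?thesis
      using s by (simp add: powr_mult powr_powr algebra_simps)
  qed
  \<comment> \<open>The Jacobian of the dilation times the homogeneity factor of the integrand; the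
    sign of the resulting exponent decides integrability.\<close>
  have pw: "(q\<^sup>2 * s\<^sup>2) * s powr (p * a / \<gamma> - p * k) = s powr ((2 + p * a) / \<gamma> + 2 - p * k)"
  proof -
    have "q\<^sup>2 = s powr (2 / \<gamma>)" "s\<^sup>2 = s powr 2"
      using s by (simp_all add: q_def power2_eq_square flip: powr_add)
    then show ?thesis
      by (simp add: add_divide_distrib algebra_simps flip: powr_add)
  qed
  have "monomial2_mass \<gamma> a k p R = ennreal (q\<^sup>2 * s\<^sup>2) *
    (\<integral>\<^sup>+z. ennreal (cmod (monomial2 a k (q *\<^sub>R fst z, s *\<^sub>R snd z)) powr p)
       * indicator {z \<in> hartogs \<gamma>. cmod (snd z) \<in> R} (q *\<^sub>R fst z, s *\<^sub>R snd z) \<partial>lborel)"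
    unfolding monomial2_mass_def
    by (rule nn_integral_lborel_c2_scale[OF q s(1) monomial2_mass_measurable[OF \<gamma> R(1)]])
  also have "\<dots> = ennreal (q\<^sup>2 * s\<^sup>2) *
    (\<integral>\<^sup>+z. ennreal (s powr (p * a / \<gamma> - p * k)) * (ennreal (cmod (monomial2 a k z) powr p)
       * indicator {z \<in> hartogs \<gamma>. cmod (snd z) \<in> (\<lambda>r. s * r) -` R} z) \<partial>lborel)"
  proof -
    have "indicator {z \<in> hartogs \<gamma>. cmod (snd z) \<in> R} (q *\<^sub>R fst z, s *\<^sub>R snd z)
        = (indicator {z \<in> hartogs \<gamma>. cmod (snd z) \<in> (\<lambda>r. s * r) -` R} z :: ennreal)" for z
      using ind[of z] by (simp only: indicator_def)
    then show ?thesis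
      by (simp only: mono ennreal_mult'[OF powr_ge_zero] mult.assoc)
  qed
  also have "\<dots> = ennreal (q\<^sup>2 * s\<^sup>2) * (ennreal (s powr (p * a / \<gamma> - p * k)) * monomial2_mass \<gamma> a k p ((\<lambda>r. s * r) -` R))"
    unfolding monomial2_mass_def using monomial2_mass_measurable[OF \<gamma> R(2)] by (subst nn_integral_cmult) auto
  also have "\<dots> = ennreal ((q\<^sup>2 * s\<^sup>2) * s powr (p * a / \<gamma> - p * k)) * monomial2_mass \<gamma> a k p ((\<lambda>r. s * r) -` R)"
    by (simp add: ennreal_mult' mult.assoc)
  finally show ?thesis
    by (simp only: pw)
qed

text \<open>Away from \<open>snd z = 0\<close> the monomial is bounded, as the first variable has
  modulus below 1, and the triangle has finite volume.\<close>

lemma monomial2_mass_atLeast_finite: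
  assumes \<gamma>: "\<gamma> > 0" and s: "s > 0" and p: "p \<ge> 0"
  shows "monomial2_mass \<gamma> a k p {s..} < \<infinity>"
proof -
  let ?B = "(1 / s ^ k) powr p"
  have "cmod (monomial2 a k z) powr p \<le> ?B" if z: "z \<in> hartogs \<gamma>" "s \<le> cmod (snd z)" for z
  proof -
    have "cmod (fst z) ^ a / cmod (snd z) ^ k \<le> 1 / s ^ k"
      using s z hartogs_norm_less[OF \<gamma> z(1)]
      by (intro frac_le power_le_one power_mono) auto
    then show ?thesis
      using p by (intro powr_mono2) (auto simp: monomial2_def norm_divide norm_power)
  qed
  then have "monomial2_mass \<gamma> a k p {s..} \<le> (\<integral>\<^sup>+z. ennreal ?B * indicator (hartogs \<gamma>) z \<partial>lborel)"
    unfolding monomial2_mass_def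
    by (intro nn_integral_mono) (auto intro!: ennreal_leI split: split_indicator)
  also have "\<dots> = ennreal ?B * emeasure lborel (hartogs \<gamma>)"
    using open_hartogs[OF \<gamma>] by (subst nn_integral_cmult) auto
  also have "\<dots> < \<infinity>"
    using lmeasurable_hartogs[OF \<gamma>] open_hartogs[OF \<gamma>]
    by (auto simp: fmeasurable_def ennreal_mult_less_top)
  finally show ?thesis .
qed

lemma vimage_mult_atLeastLessThan:
  fixes s :: real
  assumes "s > 0"
  shows "(\<lambda>r. s * r) -` {s * l..<s * u} = {l..<u}" "(\<lambda>r. s * r) -` {..<s * u} = {..<u}"
  using assms by auto

lemma monomial2_mass_full:
  "R \<supseteq> {..<1} \<Longrightarrow> monomial2_mass \<gamma> a k p R = monomial2_mass \<gamma> a k p UNIV"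
  unfolding monomial2_mass_def
  by (intro nn_integral_cong) (auto simp: hartogs_def split: split_indicator)

text \<open>Splitting at modulus 1/2 gives \<open>J (Suc n) \<le> J 1 + q * J n\<close>, where
  \<open>q < 1\<close> by the sign of the exponent. The fixed point \<open>x / (1 - q)\<close> of
  \<open>t \<mapsto> x + q * t\<close> therefore bounds every \<open>J n\<close>, and monotone
  convergence passes the bound to the whole triangle.\<close>

lemma monomial2_mass_finite:
  assumes \<gamma>: "\<gamma> > 0" and p: "p \<ge> 0" and E: "(2 + p * a) / \<gamma> + 2 - p * k > 0"
  shows "monomial2_mass \<gamma> a k p UNIV < \<infinity>"
proof -
  define q :: real where "q = (1/2) powr ((2 + p * a) / \<gamma> + 2 - p * k)"
  have q: "0 < q" "q < 1"
    using E powr_less_mono'[of "1/2::real" 0 "(2 + p * a) / \<gamma> + 2 - p * k"] by (simp_all add: q_def)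
  define J where "J = (\<lambda>n::nat. monomial2_mass \<gamma> a k p {(1/2)^n..})"
  obtain x where x: "J 1 = ennreal x" "x \<ge> 0"
    using monomial2_mass_atLeast_finite[OF \<gamma> _ p, of "1/2" a k]
    by (cases "J 1") (auto simp: J_def)
  have J_le: "J n \<le> ennreal (x / (1 - q))" for n
  proof (induction n)
    case 0
    have "J 0 \<le> J 1"
      unfolding J_def monomial2_mass_def by (intro nn_integral_mono) (auto split: split_indicator)
    also have "\<dots> \<le> ennreal (x / (1 - q))"
      using x q by (simp add: ennreal_leI pos_le_divide_eq mult_left_le)
    finally show ?case .
  next
    case (Suc n)
    \<comment> \<open>The endpoint 1/2 is written as \<open>(1/2) * 1\<close> to fit the shape
      \<open>s * u\<close> in \<open>vimage_mult_atLeastLessThan\<close>.\<close>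
    have un: "{(1/2) ^ Suc n..} = {1/2..} \<union> {(1/2) * (1/2) ^ n..<(1/2) * (1::real)}"
      using power_le_one[of "1/2::real" n] by auto
    have "J (Suc n) = J 1 + monomial2_mass \<gamma> a k p {(1/2) * (1/2) ^ n..<(1/2) * 1}"
      unfolding J_def un by (subst monomial2_mass_Un[OF \<gamma>]) auto
    also have "monomial2_mass \<gamma> a k p {(1/2) * (1/2) ^ n..<(1/2) * 1} = ennreal q * monomial2_mass \<gamma> a k p {(1/2)^n..<1}"
      unfolding q_def
      by (subst monomial2_mass_scale[OF \<gamma>, where s = "1/2"]) (simp_all only: vimage_mult_atLeastLessThan, auto)
    also have "monomial2_mass \<gamma> a k p {(1/2)^n..<1} \<le> J n"
      unfolding J_def monomial2_mass_def by (intro nn_integral_mono) (auto split: split_indicator)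
    also have "J n \<le> ennreal (x / (1 - q))"
      by (rule Suc)
    also have "J 1 + ennreal q * ennreal (x / (1 - q)) = ennreal (x + q * (x / (1 - q)))"
      using x q by (simp add: ennreal_mult'[symmetric] ennreal_plus[symmetric] del: ennreal_plus)
    also have "x + q * (x / (1 - q)) = x / (1 - q)"
      using q by (simp add: field_simps)
    finally show ?case
      by (simp add: add_left_mono mult_left_mono)
  qed
  have "monomial2_mass \<gamma> a k p UNIV
      = (\<integral>\<^sup>+z. (SUP n. ennreal (cmod (monomial2 a k z) powr p) * indicator {z \<in> hartogs \<gamma>. cmod (snd z) \<in> {(1/2)^n..}} z) \<partial>lborel)"
    unfolding monomial2_mass_def
  proof (intro nn_integral_cong antisym)
    fix z :: "complex \<times> complex"
    let ?u = "ennreal (cmod (monomial2 a k z) powr p)"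
    show "?u * indicator {z \<in> hartogs \<gamma>. cmod (snd z) \<in> UNIV} z
        \<le> (SUP n. ?u * indicator {z \<in> hartogs \<gamma>. cmod (snd z) \<in> {(1/2)^n..}} z)"
    proof (cases "z \<in> hartogs \<gamma>")
      case True
      then obtain n where "(1/2) ^ n < cmod (snd z)"
        using real_arch_pow_inv[of "cmod (snd z)" "1/2"] hartogs_norm_less[OF \<gamma>] by auto
      then show ?thesis
        using True by (intro SUP_upper2[of n]) auto
    qed simp
    show "(SUP n. ?u * indicator {z \<in> hartogs \<gamma>. cmod (snd z) \<in> {(1/2)^n..}} z)
        \<le> ?u * indicator {z \<in> hartogs \<gamma>. cmod (snd z) \<in> UNIV} z"
      by (intro SUP_least) (auto split: split_indicator)
  qed
  also have "\<dots> = (SUP n. J n)"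
    unfolding J_def monomial2_mass_def
  proof (rule nn_integral_monotone_convergence_SUP)
    show "incseq (\<lambda>n z. ennreal (cmod (monomial2 a k z) powr p) * indicator {z \<in> hartogs \<gamma>. cmod (snd z) \<in> {(1/2)^n..}} z)"
    proof (intro incseq_SucI le_funI)
      fix n :: nat and z :: "complex \<times> complex"
      have "{(1/2)^n..} \<subseteq> {(1/2::real)^Suc n..}"
        by simp
      then show "ennreal (cmod (monomial2 a k z) powr p) * indicator {z \<in> hartogs \<gamma>. cmod (snd z) \<in> {(1/2)^n..}} z
        \<le> ennreal (cmod (monomial2 a k z) powr p) * indicator {z \<in> hartogs \<gamma>. cmod (snd z) \<in> {(1/2)^Suc n..}} z"
        by (intro mult_left_mono) (auto simp: indicator_def subset_iff simp del: atLeast_iff power_Suc)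
    qed
    show "(\<lambda>z. ennreal (cmod (monomial2 a k z) powr p) * indicator {z \<in> hartogs \<gamma>. cmod (snd z) \<in> {(1/2)^n..}} z)
        \<in> borel_measurable lborel" for n
      using monomial2_mass_measurable[OF \<gamma>, of "{(1/2)^n..}" a k p] by simp
  qed
  also have "\<dots> \<le> ennreal (x / (1 - q))"
    by (rule SUP_least) (rule J_le)
  finally show ?thesis
    by (simp add: le_less_trans)
qed

text \<open>The total mass is the mass of the outer part plus at least the total mass again, because
  the scaling factor is now at least 1. If it were finite, the outer part would have mass zero,
  although it contains a nonempty open set on which the monomial does not vanish.\<close>

lemma monomial2_mass_infinite:
  assumes \<gamma>: "\<gamma> > 0" and E: "(2 + p * a) / \<gamma> + 2 - p * k \<le> 0"
  shows "monomial2_mass \<gamma> a k p UNIV = \<infinity>"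
proof (rule ccontr)
  let ?X = "monomial2_mass \<gamma> a k p {1/2..}" and ?I = "monomial2_mass \<gamma> a k p UNIV"
  assume fin: "?I \<noteq> \<infinity>"
  have "?I = monomial2_mass \<gamma> a k p ({1/2..} \<union> {..<(1/2) * 1})"
    by (rule arg_cong) auto
  also have "\<dots> = ?X + monomial2_mass \<gamma> a k p {..<(1/2) * 1}"
    by (rule monomial2_mass_Un[OF \<gamma>]) auto
  also have "monomial2_mass \<gamma> a k p {..<(1/2) * 1} =
      ennreal ((1/2) powr ((2 + p * a) / \<gamma> + 2 - p * k)) * monomial2_mass \<gamma> a k p {..<1}"
    by (subst monomial2_mass_scale[OF \<gamma>, where s = "1/2"]) (simp_all only: vimage_mult_atLeastLessThan, auto)
  also have "monomial2_mass \<gamma> a k p {..<1} = ?I"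
    by (rule monomial2_mass_full) simp
  also have "?X + ennreal ((1/2) powr ((2 + p * a) / \<gamma> + 2 - p * k)) * ?I \<ge> ?X + 1 * ?I"
    using powr_mono'[OF E, of "1/2"] by (intro add_left_mono mult_right_mono) auto
  finally have "?X + ?I \<le> ?I"
    by simp
  then have "?I + ?X = ?I + 0"
    by (intro antisym) (simp_all add: add.commute)
  then have "?X = 0"
    using fin unfolding ennreal_add_left_cancel by simp
  then have "AE z in lborel. ennreal (cmod (monomial2 a k z) powr p) * indicator {z \<in> hartogs \<gamma>. cmod (snd z) \<in> {1/2..}} z = 0"
    unfolding monomial2_mass_def
    by (subst (asm) nn_integral_0_iff_AE) (use monomial2_mass_measurable[OF \<gamma>, of "{1/2..}" a k p] in auto)
  then obtain N where N: "N \<in> null_sets lborel"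
    "{z. ennreal (cmod (monomial2 a k z) powr p) * indicator {z \<in> hartogs \<gamma>. cmod (snd z) \<in> {1/2..}} z \<noteq> 0} \<subseteq> N"
    by (auto simp: eventually_ae_filter)
  let ?O = "hartogs \<gamma> \<inter> {z. 1/2 < cmod (snd z)} \<inter> {z. fst z \<noteq> 0}"
  have "?O \<subseteq> {z. ennreal (cmod (monomial2 a k z) powr p) * indicator {z \<in> hartogs \<gamma>. cmod (snd z) \<in> {1/2..}} z \<noteq> 0}"
    using hartogs_norm_less[OF \<gamma>] by (auto simp: monomial2_def)
  then have "?O \<subseteq> N"
    using N(2) by blast
  moreover have "negligible N"
    using N(1) by (simp add: negligible_iff_null_sets null_sets_completionI)
  ultimately have "negligible ?O"
    using negligible_subset by blast
  moreover have "open ?O"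
    by (intro open_Int open_hartogs[OF \<gamma>] open_Collect_less open_Collect_neq continuous_intros)
  \<comment> \<open>The first coordinate is chosen so that its modulus to the power
    \<open>\<gamma>\<close> is 1/2, which is less than 3/4.\<close>
  moreover have "(of_real ((1/2) powr (1/\<gamma>)), 3/4) \<in> ?O"
    using \<gamma> by (simp add: hartogs_def powr_powr)
  ultimately show False
    using open_not_negligible by blast
qed

lemma monomial2_in_Lp_on_iff:
  assumes \<gamma>: "\<gamma> > 0"
  shows "monomial2 a k \<in> Lp_on (hartogs \<gamma>) p \<longleftrightarrow> monomial2_mass \<gamma> a k p UNIV < \<infinity>"
proof -
  let ?u = "\<lambda>z. cmod (monomial2 a k z) powr p"
  have id: "f \<in> borel_measurable (lebesgue_on (hartogs \<gamma>))" if "f \<in> borel_measurable borel" for f :: "_ \<Rightarrow> 'b :: topological_space"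
    using that by (intro measurable_restrict_space1 measurable_completion) simp
  have m: "?u \<in> borel_measurable borel"
    by measurable
  have eq: "(\<integral>\<^sup>+z. ennreal (?u z) \<partial>lebesgue_on (hartogs \<gamma>)) = monomial2_mass \<gamma> a k p UNIV"
    using open_hartogs[OF \<gamma>] monomial2_mass_measurable[OF \<gamma>, of UNIV a k p]
    by (simp add: nn_integral_restrict_space nn_integral_completion monomial2_mass_def)
  show ?thesis
    unfolding Lp_on_def mem_Collect_eq integrable_iff_bounded
    using id[OF monomial2_borel, of a k] id[OF m] eq by simp
qed

text \<open>Positivity of the scaling exponent, multiplied through by \<open>\<gamma>\<close>. For
  \<open>p = 2\<close> it reads \<open>\<gamma> * k - a < 1 + \<gamma>\<close>.\<close>

lemma monomial2_in_Lp_on_hartogs_iff: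
  assumes \<gamma>: "\<gamma> > 0" and p: "p \<ge> 0"
  shows "monomial2 a k \<in> Lp_on (hartogs \<gamma>) p \<longleftrightarrow> p * (\<gamma> * k - a) < 2 + 2 * \<gamma>"
proof -
  have "(2 + p * a) / \<gamma> + 2 - p * k > 0 \<longleftrightarrow> p * (\<gamma> * k - a) < 2 + 2 * \<gamma>"
    using \<gamma> by (simp add: field_simps)
  then show ?thesis
    using monomial2_mass_finite[OF \<gamma> p, of a k] monomial2_mass_infinite[OF \<gamma>, of p a k]
    by (auto simp: monomial2_in_Lp_on_iff[OF \<gamma>] not_less)
qed

section \<open>Arithmetic of the exponents\<close>

lemma coprime_linear_combination_nat:
  fixes m n N :: nat
  assumes "coprime m n" "m > 0"
  obtains a k where "m * k = n * a + N"
proof -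
  \<comment> \<open>This form of the Bezout identity has natural coefficients, so scaling by
    \<open>N\<close> directly gives admissible exponents.\<close>
  obtain x y where "m * x = n * y + gcd m n"
    using bezout_nat[of m n] assms by blast
  then have "m * (x * N) = n * (y * N) + N"
    using assms(1) by (simp add: mult.assoc[symmetric] add_mult_distrib)
  then show thesis
    using that by blast
qed

text \<open>Density of the fractional parts of an irrational number yields integers, but the
  subtracted integer \<open>h\<close> could be negative. Working with a multiple of
  \<open>\<gamma>\<close> that exceeds \<open>u\<close> forces \<open>h\<close> to be
  positive.\<close>

lemma irrational_exponents:
  fixes \<gamma> l u :: real
  assumes "\<gamma> \<notin> \<rat>" "\<gamma> > 0" "0 < l" "l < u"
  obtains a k :: nat where "l < \<gamma> * k - a" "\<gamma> * k - a < u"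
proof -
  obtain M :: nat where M: "M > 0" "real M * \<gamma> > u"
    using reals_Archimedean3[OF assms(2)] assms(3,4) by (metis gr_zeroI less_trans mult_zero_left of_nat_0 not_less_iff_gr_or_eq)
  have irr: "real M * \<gamma> \<notin> \<rat>"
    using assms(1) M(1) by (metis Rats_divide Rats_of_nat nonzero_mult_div_cancel_left of_nat_0_less_iff order_less_irrefl)
  have "0 < (u - l) / 2"
    using assms by simp
  \<comment> \<open>Midpoint and half-length of the interval from \<open>l\<close> to
    \<open>u\<close>: the estimate says that the difference lies strictly inside it.\<close>
  then obtain h j where hj: "j > 0" "\<bar>of_int j * (real M * \<gamma>) - of_int h - (l + u) / 2\<bar> < (u - l) / 2"
    by (rule sequence_of_fractional_parts_is_dense[OF irr])
  define x where "x = of_int j * (real M * \<gamma>)"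
  have "real M * \<gamma> \<le> x"
    unfolding x_def using hj(1) M(2) assms by (simp add: mult_le_cancel_right1)
  moreover have x: "l < x - of_int h" "x - of_int h < u"
    using hj(2) unfolding x_def[symmetric] by (simp_all add: abs_less_iff field_simps)
  ultimately have "of_int h > (0::real)"
    using M(2) by linarith
  then have h: "h > 0"
    by simp
  show thesis
  proof (rule that[of "nat j * M" "nat h"])
    have "\<gamma> * real (nat j * M) - real (nat h) = x - of_int h"
      using h hj(1) by (simp add: x_def)
    then show "l < \<gamma> * real (nat j * M) - real (nat h)" "\<gamma> * real (nat j * M) - real (nat h) < u"
      using x by simp_all
  qed
qed

subsection \<open>Toeplitz operators with radial symbols\<close>

lemma bounded_in_Lp_on:
  assumes \<Omega>: "\<Omega> \<in> lmeasurable" and f: "f \<in> borel_measurable (lebesgue_on \<Omega>)"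
    and B: "\<And>z. z \<in> \<Omega> \<Longrightarrow> cmod (f z) \<le> B" and p: "p \<ge> 0"
  shows "f \<in> Lp_on \<Omega> p"
proof -
  interpret finite_measure "lebesgue_on \<Omega>"
    by (rule finite_measure_lebesgue_on[OF \<Omega>])
  have "integrable (lebesgue_on \<Omega>) (\<lambda>z. cmod (f z) powr p)"
  proof (rule integrable_const_bound)
    show "AE z in lebesgue_on \<Omega>. norm (cmod (f z) powr p) \<le> B powr p"
      using B p by (intro AE_I2) (auto intro: powr_mono2)
    show "(\<lambda>z. cmod (f z) powr p) \<in> borel_measurable (lebesgue_on \<Omega>)"
      using f by measurable
  qed
  then show ?thesis
    using f by (simp add: Lp_on_def)
qed

lemma holomorphic2_on_monomial2:
  assumes "\<And>z. z \<in> \<Omega> \<Longrightarrow> snd z \<noteq> 0"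
  shows "holomorphic2_on (\<lambda>z. if z \<in> \<Omega> then c * monomial2 a k z else 0) \<Omega>"
  unfolding holomorphic2_on_def
proof
  fix z assume z: "z \<in> \<Omega>"
  let ?p = "\<lambda>w::complex. w ^ a" and ?q = "\<lambda>w::complex. inverse (w ^ k)"
  have "?p field_differentiable at (fst z)"
    by (intro field_differentiable_power field_differentiable_ident)
  then obtain D\<^sub>1 where D1: "(?p has_derivative (*) D\<^sub>1) (at (fst z))"
    by (auto simp: field_differentiable_def has_field_derivative_def)
  have "?q field_differentiable at (snd z)"
    using assms[OF z] by (intro field_differentiable_inverse field_differentiable_power field_differentiable_ident) simp
  then obtain D\<^sub>2 where D2: "(?q has_derivative (*) D\<^sub>2) (at (snd z))"
    by (auto simp: field_differentiable_def has_field_derivative_def)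
  have "((\<lambda>z. ?p (fst z)) has_derivative (\<lambda>h. D\<^sub>1 * fst h)) (at z within \<Omega>)"
    by (rule has_derivative_compose[OF has_derivative_fst[OF has_derivative_ident] D1])
  moreover have "((\<lambda>z. ?q (snd z)) has_derivative (\<lambda>h. D\<^sub>2 * snd h)) (at z within \<Omega>)"
    by (rule has_derivative_compose[OF has_derivative_snd[OF has_derivative_ident] D2])
  ultimately have "((\<lambda>z. c * (?p (fst z) * ?q (snd z))) has_derivative
      (\<lambda>h. c * (?p (fst z) * (D\<^sub>2 * snd h) + D\<^sub>1 * fst h * ?q (snd z)))) (at z within \<Omega>)"
    by (intro has_derivative_mult_right has_derivative_mult)
  then have "((\<lambda>z. if z \<in> \<Omega> then c * monomial2 a k z else 0) has_derivative
      (\<lambda>h. c * (?p (fst z) * (D\<^sub>2 * snd h) + D\<^sub>1 * fst h * ?q (snd z)))) (at z within \<Omega>)"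
    by (rule has_derivative_transform[OF z, rotated]) (simp add: monomial2_def divide_inverse)
  moreover have "(\<lambda>h. c * (?p (fst z) * (D\<^sub>2 * snd h) + D\<^sub>1 * fst h * ?q (snd z)))
      = (\<lambda>(h\<^sub>1, h\<^sub>2). (c * D\<^sub>1 * ?q (snd z)) * h\<^sub>1 + (c * D\<^sub>2 * ?p (fst z)) * h\<^sub>2)"
    by (auto simp: algebra_simps)
  ultimately show "\<exists>a' b'. ((\<lambda>z. if z \<in> \<Omega> then c * monomial2 a k z else 0) has_derivative
      (\<lambda>(h\<^sub>1, h\<^sub>2). a' * h\<^sub>1 + b' * h\<^sub>2)) (at z within \<Omega>)"
    by metis
qed

lemma radial_on_rot:
  assumes "radial_on (hartogs \<gamma>) \<phi>" "z \<in> hartogs \<gamma>"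
  shows "\<phi> (rot \<theta> z) = \<phi> z"
proof -
  have "\<phi> w = \<phi> (complex_of_real (cmod (fst w)), complex_of_real (cmod (snd w)))" if "w \<in> hartogs \<gamma>" for w
    using assms(1) that by (auto simp: radial_on_def)
  from this[OF assms(2)] this[of "rot \<theta> z"] show ?thesis
    using assms(2) by (simp add: rot_in_hartogs_iff) (simp add: rot_def norm_mult)
qed

text \<open>Positivity is required only off \<open>fst z = 0\<close>, since the integrands contain
  powers of \<open>fst z\<close> that may vanish there; that set is null.\<close>

lemma integral_hartogs_pos:
  assumes \<gamma>: "\<gamma> > 0" and f: "integrable (lebesgue_on (hartogs \<gamma>)) f"
    and pos: "\<And>z. z \<in> hartogs \<gamma> \<Longrightarrow> fst z \<noteq> 0 \<Longrightarrow> f z > (0 :: real)"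
  shows "(LINT z|lebesgue_on (hartogs \<gamma>). f z) > 0"
proof -
  have "hartogs \<gamma> \<in> sets lebesgue"
    using lmeasurable_hartogs[OF \<gamma>] by blast
  from AE_fst_nonzero[OF this] AE_space[of "lebesgue_on (hartogs \<gamma>)"]
  have "AE z in lebesgue_on (hartogs \<gamma>). 0 < f z"
    by eventually_elim (use pos in auto)
  then have "(LINT z|lebesgue_on (hartogs \<gamma>). 0) < (LINT z|lebesgue_on (hartogs \<gamma>). f z)"
    using f emeasure_hartogs_pos[OF \<gamma>]
    by (intro finite_measure.integral_less_AE_space finite_measure_lebesgue_on lmeasurable_hartogs \<gamma>) auto
  then show ?thesis
    by simp
qed

text \<open>The symbol times the test function and the monomial are covariant under the same
  character. Their difference, with the right constant, is therefore orthogonal to all of A^2 as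
  soon as it is orthogonal to the monomial.\<close>

lemma toeplitz_monomial2:
  assumes \<gamma>: "\<gamma> > 0"
    and \<phi>: "\<phi> \<in> borel_measurable (lebesgue_on (hartogs \<gamma>))"
      "\<And>z. z \<in> hartogs \<gamma> \<Longrightarrow> \<phi> z > 0"
      "bounded (\<phi> ` hartogs \<gamma>)" "radial_on (hartogs \<gamma>) \<phi>"
    and mono: "monomial2 a k \<in> Lp_on (hartogs \<gamma>) 2"
  obtains c where "c \<noteq> 0"
    "toeplitz (hartogs \<gamma>) \<phi> (\<lambda>z. fst z ^ a * cnj (snd z) ^ k)
      = (\<lambda>z. if z \<in> hartogs \<gamma> then c * monomial2 a k z else 0)"
proof -
  let ?\<Omega> = "hartogs \<gamma>"
  let ?N = "lebesgue_on ?\<Omega>"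
  let ?m = "monomial2 a k"
  define f where "f = (\<lambda>z::complex \<times> complex. fst z ^ a * cnj (snd z) ^ k)"
  obtain B where B: "\<And>z. z \<in> ?\<Omega> \<Longrightarrow> \<bar>\<phi> z\<bar> \<le> B"
    using \<phi>(3) by (auto simp: bounded_iff)
  have f_le: "cmod (f z) \<le> 1" if "z \<in> ?\<Omega>" for z
    using hartogs_norm_less[OF \<gamma> that]
    by (auto simp: f_def norm_mult norm_power intro!: mult_le_one power_le_one)
  have "f \<in> borel_measurable borel"
    unfolding f_def by (intro borel_measurable_continuous_onI continuous_intros)
  then have fN: "f \<in> borel_measurable ?N"
    by (intro measurable_restrict_space1 measurable_completion) simp
  have \<phi>f: "(\<lambda>z. complex_of_real (\<phi> z) * f z) \<in> Lp_on ?\<Omega> 2"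
  proof (rule bounded_in_Lp_on[OF lmeasurable_hartogs[OF \<gamma>]])
    show "(\<lambda>z. complex_of_real (\<phi> z) * f z) \<in> borel_measurable ?N"
      by (intro borel_measurable_times measurable_compose[OF \<phi>(1) borel_measurable_of_real] fN)
    show "cmod (complex_of_real (\<phi> z) * f z) \<le> B * 1" if "z \<in> ?\<Omega>" for z
      unfolding norm_mult using B[OF that] f_le[OF that] by (intro mult_mono) auto
  qed simp
  have int1: "integrable ?N (\<lambda>z. complex_of_real (\<phi> z) * f z * cnj (?m z))"
    and int2: "integrable ?N (\<lambda>z. ?m z * cnj (?m z))"
    using \<phi>f mono by (auto simp: Lp_on_def intro!: L2_mult_cnj_integrable)
  \<comment> \<open>The inner product of the symbol times \<open>f\<close> with the monomial:
    \<open>cnj (snd z) ^ k\<close> cancels the conjugate denominator. Positivity of the symbol makes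
    the integral positive.\<close>
  define I\<^sub>1 where "I\<^sub>1 = (LINT z|?N. \<phi> z * cmod (fst z) ^ (2 * a))"
  define I\<^sub>2 where "I\<^sub>2 = (LINT z|?N. (cmod (?m z))\<^sup>2)"
  have e1: "complex_of_real (\<phi> z) * f z * cnj (?m z) = complex_of_real (\<phi> z * cmod (fst z) ^ (2 * a))"
    if "z \<in> space ?N" for z
  proof -
    have "fst z ^ a * cnj (fst z) ^ a = complex_of_real (cmod (fst z) ^ (2 * a))"
      by (metis complex_norm_square of_real_power power_mult power_mult_distrib)
    then show ?thesis
      using hartogs_norm_less(3)[OF \<gamma>] that by (simp add: f_def monomial2_def field_simps)
  qed
  have e2: "?m z * cnj (?m z) = complex_of_real ((cmod (?m z))\<^sup>2)" for z
    by (simp only: complex_norm_square)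
  have int1': "integrable ?N (\<lambda>z. complex_of_real (\<phi> z * cmod (fst z) ^ (2 * a)))"
    using int1 by (subst Bochner_Integration.integrable_cong[OF refl e1[symmetric]]) auto
  have int2': "integrable ?N (\<lambda>z. complex_of_real ((cmod (?m z))\<^sup>2))"
    using int2 unfolding e2 .
  have I1: "I\<^sub>1 > 0"
    unfolding I\<^sub>1_def
  proof (rule integral_hartogs_pos[OF \<gamma>])
    show "integrable ?N (\<lambda>z. \<phi> z * cmod (fst z) ^ (2 * a))"
      using int1' by (simp only: complex_of_real_integrable_eq)
    show "\<phi> z * cmod (fst z) ^ (2 * a) > 0" if "z \<in> ?\<Omega>" "fst z \<noteq> 0" for z
      using \<phi>(2) that by (intro mult_pos_pos zero_less_power) auto
  qed
  have I2: "I\<^sub>2 > 0"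
    unfolding I\<^sub>2_def
  proof (rule integral_hartogs_pos[OF \<gamma>])
    show "integrable ?N (\<lambda>z. (cmod (?m z))\<^sup>2)"
      using int2' by (simp only: complex_of_real_integrable_eq)
    show "(cmod (?m z))\<^sup>2 > 0" if "z \<in> ?\<Omega>" "fst z \<noteq> 0" for z
      using hartogs_norm_less(3)[OF \<gamma> that(1)] that(2) by (simp add: monomial2_def)
  qed
  \<comment> \<open>The only value that makes the difference orthogonal to the monomial, since
    \<open>I\<^sub>2\<close> is the squared norm of the latter.\<close>
  define c where "c = complex_of_real (I\<^sub>1 / I\<^sub>2)"
  define g where "g = (\<lambda>z. if z \<in> ?\<Omega> then c * ?m z else 0)"
  have gN: "g z = c * ?m z" if "z \<in> space ?N" for z
    using that by (simp add: g_def)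
  have "g \<in> borel_measurable ?N"
    using mono gN by (subst measurable_cong[OF gN]) (auto simp: Lp_on_def intro!: borel_measurable_times)
  moreover have "integrable ?N (\<lambda>z. cmod (g z) powr 2)"
  proof -
    have "integrable ?N (\<lambda>z. (cmod c)\<^sup>2 * cmod (?m z) powr 2)"
      using mono by (simp add: Lp_on_def)
    then show ?thesis
      by (subst Bochner_Integration.integrable_cong[OF refl, where g = "\<lambda>z. (cmod c)\<^sup>2 * cmod (?m z) powr 2"])
         (simp_all add: gN norm_mult power_mult_distrib)
  qed
  ultimately have gLp: "g \<in> Lp_on ?\<Omega> 2"
    by (simp add: Lp_on_def)
  have gAp: "g \<in> Ap_on ?\<Omega> 2"
    unfolding Ap_on_def using gLp holomorphic2_on_monomial2[OF hartogs_norm_less(3)[OF \<gamma>]]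
    by (auto simp: g_def)
  define F where "F = (\<lambda>z. complex_of_real (\<phi> z) * f z - g z)"
  have FLp: "F \<in> Lp_on ?\<Omega> 2"
    unfolding F_def by (rule Lp_on_2_diff[OF \<phi>f gLp])
  have cov: "F (rot \<theta> z) = cis (real a * fst \<theta> - real k * snd \<theta>) * F z" if z: "z \<in> ?\<Omega>" for \<theta> z
  proof -
    have "f (rot \<theta> z) = cis (real a * fst \<theta> - real k * snd \<theta>) * f z"
      by (simp add: f_def rot_def power_mult_distrib Complex.DeMoivre cis_cnj cis_mult mult_ac flip: cis_divide)
    moreover have "?m (rot \<theta> z) = cis (real a * fst \<theta> - real k * snd \<theta>) * ?m z"
      by (simp add: monomial2_def rot_def power_mult_distrib Complex.DeMoivre mult_ac flip: cis_divide)
    ultimately show ?thesis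
      using z radial_on_rot[OF \<phi>(4) z] by (simp add: F_def g_def rot_in_hartogs_iff algebra_simps)
  qed
  have orth: "L2_inner ?\<Omega> F ?m = 0"
  proof -
    have "L2_inner ?\<Omega> F ?m = (LINT z|?N. complex_of_real (\<phi> z) * f z * cnj (?m z)) - (LINT z|?N. g z * cnj (?m z))"
      using L2_inner_diff_left[OF \<phi>f gLp mono] by (simp only: F_def L2_inner_def)
    also have "(LINT z|?N. complex_of_real (\<phi> z) * f z * cnj (?m z)) = complex_of_real I\<^sub>1"
      unfolding I\<^sub>1_def integral_complex_of_real[symmetric] by (rule Bochner_Integration.integral_cong[OF refl e1])
    also have "(LINT z|?N. g z * cnj (?m z)) = (LINT z|?N. c * complex_of_real ((cmod (?m z))\<^sup>2))"
      by (rule Bochner_Integration.integral_cong[OF refl]) (simp only: gN e2[symmetric] mult.assoc)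
    also have "\<dots> = c * complex_of_real I\<^sub>2"
      unfolding I\<^sub>2_def integral_complex_of_real[symmetric] by (rule integral_mult_right_zero)
    finally show ?thesis
      using I2 by (simp add: c_def)
  qed
  have "toeplitz ?\<Omega> \<phi> f = g"
    unfolding toeplitz_def
  proof (rule bergman_projection_eqI[OF open_hartogs[OF \<gamma>] \<phi>f gAp])
    show "g z = 0" if "z \<notin> ?\<Omega>" for z
      using that by (simp add: g_def)
    show "L2_inner ?\<Omega> (\<lambda>z. complex_of_real (\<phi> z) * f z - g z) h = 0" if "h \<in> Ap_on ?\<Omega> 2" for h
      using L2_inner_covariant_eq_0[OF \<gamma> FLp cov that orth] by (simp only: F_def)
  qed
  moreover have "c \<noteq> 0"
    using I1 I2 by (simp add: c_def)
  ultimately show thesis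
    using that by (simp only: f_def g_def)
qed

text \<open>The two inequalities on \<open>a\<close> and \<open>k\<close> say that the monomial is
  in L^2 but not in L^p. The operator sends a bounded function to a nonzero multiple of it.\<close>

lemma toeplitz_not_Lp:
  fixes a k :: nat
  assumes \<gamma>: "\<gamma> > 0"
    and \<phi>: "\<phi> \<in> borel_measurable (lebesgue_on (hartogs \<gamma>))"
      "\<And>z. z \<in> hartogs \<gamma> \<Longrightarrow> \<phi> z > 0"
      "bounded (\<phi> ` hartogs \<gamma>)" "radial_on (hartogs \<gamma>) \<phi>"
    and p: "p \<ge> 0" and ak: "\<gamma> * k - a < 1 + \<gamma>" "p * (\<gamma> * k - a) \<ge> 2 + 2 * \<gamma>"
  shows "\<exists>f \<in> Lp_on (hartogs \<gamma>) p. toeplitz (hartogs \<gamma>) \<phi> f \<notin> Ap_on (hartogs \<gamma>) p"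
proof -
  let ?\<Omega> = "hartogs \<gamma>"
  let ?m = "monomial2 a k"
  let ?f = "\<lambda>z::complex \<times> complex. fst z ^ a * cnj (snd z) ^ k"
  have "?m \<in> Lp_on ?\<Omega> 2"
    using monomial2_in_Lp_on_hartogs_iff[OF \<gamma>, of 2 a k] ak(1) by simp
  then obtain c where c: "c \<noteq> 0" "toeplitz ?\<Omega> \<phi> ?f = (\<lambda>z. if z \<in> ?\<Omega> then c * ?m z else 0)"
    using toeplitz_monomial2[OF \<gamma> \<phi>] by blast
  have "?f \<in> Lp_on ?\<Omega> p"
  proof (rule bounded_in_Lp_on[OF lmeasurable_hartogs[OF \<gamma>] _ _ p])
    have "?f \<in> borel_measurable borel"
      by (intro borel_measurable_continuous_onI continuous_intros)
    then show "?f \<in> borel_measurable (lebesgue_on ?\<Omega>)"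
      by (intro measurable_restrict_space1 measurable_completion) simp
    show "cmod (?f z) \<le> 1" if "z \<in> ?\<Omega>" for z
      using hartogs_norm_less[OF \<gamma> that]
      by (auto simp: norm_mult norm_power intro!: mult_le_one power_le_one)
  qed
  moreover have "toeplitz ?\<Omega> \<phi> ?f \<notin> Ap_on ?\<Omega> p"
  proof
    assume "toeplitz ?\<Omega> \<phi> ?f \<in> Ap_on ?\<Omega> p"
    then have "integrable (lebesgue_on ?\<Omega>) (\<lambda>z. cmod (if z \<in> ?\<Omega> then c * ?m z else 0) powr p)"
      by (simp add: c(2) Ap_on_def Lp_on_def)
    also have "?this \<longleftrightarrow> integrable (lebesgue_on ?\<Omega>) (\<lambda>z. cmod c powr p * cmod (?m z) powr p)"
      by (rule Bochner_Integration.integrable_cong) (auto simp: norm_mult powr_mult)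
    finally have "integrable (lebesgue_on ?\<Omega>) (\<lambda>z. cmod (?m z) powr p)"
      using c(1) by (simp add: integrable_mult_right_iff)
    moreover have "?m \<in> borel_measurable (lebesgue_on ?\<Omega>)"
      by (intro measurable_restrict_space1 measurable_completion) simp
    ultimately have "?m \<in> Lp_on ?\<Omega> p"
      by (simp add: Lp_on_def)
    then show False
      using ak(2) monomial2_in_Lp_on_hartogs_iff[OF \<gamma> p] by simp
  qed
  ultimately show ?thesis
    by blast
qed

theorem corollary2p7:
  fixes \<gamma> :: real and \<phi> :: "complex \<times> complex \<Rightarrow> real"
  assumes "\<gamma> > 0"
    and "\<phi> \<in> borel_measurable (lebesgue_on (hartogs \<gamma>))"
    and "\<And>z. z \<in> hartogs \<gamma> \<Longrightarrow> \<phi> z > 0"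
    and "bounded (\<phi> ` hartogs \<gamma>)"
    and "radial_on (hartogs \<gamma>) \<phi>"
  shows "(\<forall>m n :: nat. m > 0 \<longrightarrow> n > 0 \<longrightarrow> coprime m n \<longrightarrow> \<gamma> = real m / real n \<longrightarrow>
            (\<forall>p :: real. p \<ge> (2 * real m + 2 * real n) / (real m + real n - 1) \<longrightarrow>
               (\<exists>f \<in> Lp_on (hartogs \<gamma>) p. toeplitz (hartogs \<gamma>) \<phi> f \<notin> Ap_on (hartogs \<gamma>) p)))
       \<and> (\<gamma> \<notin> \<rat> \<longrightarrow>
            (\<forall>p :: real. p > 2 \<longrightarrow>
               (\<exists>f \<in> Lp_on (hartogs \<gamma>) p. toeplitz (hartogs \<gamma>) \<phi> f \<notin> Ap_on (hartogs \<gamma>) p)))"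
proof (intro conjI allI impI)
  fix m n :: nat and p :: real
  assume mn: "m > 0" "n > 0" "coprime m n" "\<gamma> = real m / real n"
    and p: "p \<ge> (2 * real m + 2 * real n) / (real m + real n - 1)"
  \<comment> \<open>The value of \<open>\<gamma> * k - a\<close> is a multiple of
    \<open>1 / n\<close> and must stay below \<open>(m + n) / n\<close>, so \<open>m + n - 1\<close>
    is the largest possible numerator.\<close>
  obtain a k where "m * k = n * a + (m + n - 1)"
    using coprime_linear_combination_nat[OF mn(3,1)] by blast
  then have "real (m * k) = real (n * a + (m + n - 1))"
    by simp
  then have eq: "\<gamma> * k - a = (real m + real n - 1) / n"
    using mn(1,2) unfolding mn(4) by (simp add: of_nat_diff field_simps)
  have pos: "real m + real n - 1 > 0"
    using mn by simp
  have "0 \<le> (2 * real m + 2 * real n) / (real m + real n - 1)"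
    using pos by simp
  then have p0: "p \<ge> 0"
    using p by linarith
  have "\<gamma> * k - a < 1 + \<gamma>"
    unfolding eq unfolding mn(4) using mn(1,2) by (simp add: field_simps)
  moreover have "p * (\<gamma> * k - a) \<ge> 2 + 2 * \<gamma>"
  proof -
    have "2 * real m + 2 * real n \<le> p * (real m + real n - 1)"
      using p pos by (simp add: pos_divide_le_eq)
    then have "(2 * real m + 2 * real n) / n \<le> p * (real m + real n - 1) / n"
      by (intro divide_right_mono) auto
    moreover have "2 + 2 * \<gamma> = (2 * real m + 2 * real n) / n"
      unfolding mn(4) using mn(2) by (simp add: field_simps)
    ultimately show ?thesis
      unfolding eq by simp
  qed
  ultimately show "\<exists>f \<in> Lp_on (hartogs \<gamma>) p. toeplitz (hartogs \<gamma>) \<phi> f \<notin> Ap_on (hartogs \<gamma>) p"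
    by - (rule toeplitz_not_Lp[OF assms p0])
next
  fix p :: real
  assume irr: "\<gamma> \<notin> \<rat>" and p: "p > 2"
  \<comment> \<open>The condition \<open>p > 2\<close> is what makes the interval from
    \<open>(2 + 2 * \<gamma>) / p\<close> to \<open>1 + \<gamma>\<close> nonempty: exponents in it
    give monomials in L^2 but not in L^p.\<close>
  have "2 * (1 + \<gamma>) < p * (1 + \<gamma>)"
    using p assms(1) by (intro mult_strict_right_mono) auto
  then have "0 < (2 + 2 * \<gamma>) / p" "(2 + 2 * \<gamma>) / p < 1 + \<gamma>"
    using p assms(1) by (auto simp: field_simps)
  then obtain a k :: nat where ak: "(2 + 2 * \<gamma>) / p < \<gamma> * k - a" "\<gamma> * k - a < 1 + \<gamma>"
    using irrational_exponents[OF irr assms(1)] by blast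
  have "2 + 2 * \<gamma> \<le> p * (\<gamma> * k - a)"
    using ak(1) p by (simp add: field_simps)
  then show "\<exists>f \<in> Lp_on (hartogs \<gamma>) p. toeplitz (hartogs \<gamma>) \<phi> f \<notin> Ap_on (hartogs \<gamma>) p"
    using toeplitz_not_Lp[OF assms _ ak(2)] p by simp
qed

end
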